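(* Let $\alpha>2$, $\beta,\theta,\Omega,n,\zeta>0$ and let $m$ be a positive integer. Suppose the SINR takes the general form $$\gamma=\frac{W}{Y+\sum_{\ell}|X_\ell|^{-\alpha}\Psi_{\ell 0}+1},$$ where $W\sim\mathrm{Gamma}(m,\theta)$; $\{X_\ell\}$ is a homogeneous Poisson point process on $\mathbb{R}^2$ of intensity $\mu$; the marks $\Psi_{\ell 0}$ are i.i.d. $\mathrm{Gamma}(n,\Omega)$; $Y$ is either $\mathrm{Gamma}(u,\Upsilon)$ with $u,\Upsilon>0$, or identically $0$; all mutually independent. Let $$\mathrm{F}^{\mathrm{SU}}(\beta)=\Pr\left(\frac{W}{Y+1}\le\beta\right)=1-e^{-\beta/\theta}\sum_{k=0}^{m-1}\frac{(\beta/\theta)^{k}}{k!}\sum_{\tau=0}^{k}\binom{k}{\tau}\mathrm{E}_Y\left[e^{-\beta Y/\theta}Y^{\tau}\right]$$ be the outage probability with no multi-node interference. Then the transmission capacity $\mathrm{c}(\epsilon)$, as $\epsilon-\mathrm{F}^{\mathrm{SU}}(\beta)\to 0$, can be written as $$\mathrm{c}(\epsilon)=\frac{\zeta\,\theta^{2/\alpha}\,\Gamma(n)\Gamma(m)}{\pi\beta^{2/\alpha}\Omega^{2/\alpha}\Gamma\left(n+\frac{2}{\alpha}\right)\Gamma\left(m-\frac{2}{\alpha}\right)}\cdot\frac{\left(\epsilon-\mathrm{F}^{\mathrm{SU}}(\beta)\right)^{+}}{\mathcal{E}}+O\left(\left(\left(\epsilon-\mathrm{F}^{\mathrm{SU}}(\beta)\right)^{2}\right)^{+}\right),$$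 where $$\mathcal{E}=\mathrm{E}_Y\left[e^{-\frac{\beta(Y+1)}{\theta}}\,{}_1F_1\left(1-m,\,1+\tfrac{2}{\alpha}-m,\,\tfrac{\beta(Y+1)}{\theta}\right)\right]=\frac{e^{-\beta/\theta}}{\Gamma\left(m-\frac{2}{\alpha}\right)}\sum_{\ell=0}^{m-1}\binom{m-1}{\ell}\left(\frac{\beta}{\theta}\right)^{\ell}\Gamma\left(m-\ell-\tfrac{2}{\alpha}\right)\sum_{\tau=0}^{\ell}\binom{\ell}{\tau}\mathrm{E}_Y\left[e^{-\beta Y/\theta}Y^{\tau}\right],$$ and, when $Y\sim\mathrm{Gamma}(u,\Upsilon)$, $\mathrm{E}_Y[e^{-\beta Y/\theta}Y^{\tau}]=\frac{\Gamma(\tau+u)}{\Gamma(u)\Upsilon^{u}}\left(\frac{\beta}{\theta}+\frac{1}{\Upsilon}\right)^{-\tau-u}$.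
   Context: $\mathrm{Gamma}(v,\vartheta)$ denotes the gamma distribution with shape $v$ and scale $\vartheta$. $(a)^{+}=\max(a,0)$; ${}_1F_1$ is the Kummer confluent hypergeometric function; $0^0=1$. Let $\mathrm{F}(\beta;\mu)=\Pr(\gamma\le\beta)$ be the outage probability when the interferer intensity is $\mu$. The transmission capacity is defined as $\mathrm{c}(\epsilon)=\zeta\,\mu(\epsilon)(1-\epsilon)$, where the contention density $\mu(\epsilon)$ is the inverse of $\epsilon=\mathrm{F}(\beta;\mu)$ taken with respect to $\mu$; here $\mu$ is the intensity of active transmitters ($\mu=\lambda p$ in a slotted ALOHA network with node intensity $\lambda$ and transmission probability $p$). An outage constraint $\epsilon$ below $\mathrm{F}^{\mathrm{SU}}(\beta)$ can never be met, and the transmission capacity is then zero. The constant $\zeta$ is the average number of transmitted symbols per node per channel use.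
   Formalization: The leading term of c(ε) is multiplied by an extra factor (1−ε); without it the expansion is false for all parameters, e.g. for m=1, Y=0 the true slope at F^SU is (1−F^SU) times the printed one. *)

theory Defs
  imports "HOL-Probability.Probability" "HOL-Library.Landau_Symbols"
begin

text \<open>Gamma distribution with real shape \<open>v\<close> and \<^emph>\<open>scale\<close> (not rate) \<open>s\<close>; the library's
  \<open>erlang_density\<close> only covers integer shapes.\<close>

definition gamma_density :: "real \<Rightarrow> real \<Rightarrow> real \<Rightarrow> real" where
  "gamma_density v s x =
     (if x \<le> 0 then 0 else x powr (v - 1) * exp (- x / s) / (Gamma v * s powr v))"

definition gamma_distributed :: "'w measure \<Rightarrow> ('w \<Rightarrow> real) \<Rightarrow> real \<Rightarrow> real \<Rightarrow> bool" where
  "gamma_distributed M Z v s \<longleftrightarrow> distributed M lborel Z (\<lambda>x. ennreal (gamma_density v s x))"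

text \<open>Kummer's confluent hypergeometric series, for \<open>b\<close> not a nonpositive
  integer.\<close>

definition kummer_1F1 :: "real \<Rightarrow> real \<Rightarrow> real \<Rightarrow> real" where
  "kummer_1F1 a b z = (\<Sum>k. pochhammer a k / pochhammer b k * z ^ k / fact k)"

text \<open>A homogeneous Poisson point process of intensity \<open>\<mu> > 0\<close> on the plane has infinitely many
  points almost surely, so it is given by a measurable enumeration \<open>X 0, X 1, \<dots>\<close> of its points.
  Since \<open>card\<close> of an infinite set is 0, finiteness is stated separately; it follows that the
  counts of bounded Borel sets are almost surely finite. The explicit Poisson weights also cover
  null sets \<open>B\<close>, for which the rate is 0 and \<open>poisson_pmf\<close> is unspecified.\<close>

definition point_count :: "(nat \<Rightarrow> 'w \<Rightarrow> real^2) \<Rightarrow> (real^2) set \<Rightarrow> 'w \<Rightarrow> nat" where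
  "point_count X B \<omega> = card {l. X l \<omega> \<in> B}"

definition homogeneous_PPP :: "'w measure \<Rightarrow> real \<Rightarrow> (nat \<Rightarrow> 'w \<Rightarrow> real^2) \<Rightarrow> bool" where
  "homogeneous_PPP M \<mu> X \<longleftrightarrow>
     (\<forall>l. X l \<in> borel_measurable M) \<and>
     (\<forall>B \<in> sets borel. bounded B \<longrightarrow>
        (\<forall>k. measure M {\<omega> \<in> space M. finite {l. X l \<omega> \<in> B} \<and> point_count X B \<omega> = k} =
               (\<mu> * measure lborel B) ^ k / fact k * exp (- (\<mu> * measure lborel B)))) \<and>
     (\<forall>B :: nat \<Rightarrow> (real^2) set.
        (\<forall>j. B j \<in> sets borel \<and> bounded (B j)) \<and> disjoint_family B \<longrightarrow>
        prob_space.indep_vars M (\<lambda>_. count_space UNIV) (\<lambda>j. point_count X (B j)) UNIV)"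

text \<open>Mutual independence of the signal \<open>W\<close>, the variable \<open>Y\<close>, the point process \<open>X\<close> (as one
  object) and the individual marks \<open>\<Psi> 0, \<Psi> 1, \<dots>\<close>. These take values in different types, so
  independence is that of the generated sigma-algebras.\<close>

datatype source = Signal | Self_Interference | Points | Mark nat

fun source_events ::
  "'w measure \<Rightarrow> ('w \<Rightarrow> real) \<Rightarrow> ('w \<Rightarrow> real) \<Rightarrow> (nat \<Rightarrow> 'w \<Rightarrow> real^2) \<Rightarrow> (nat \<Rightarrow> 'w \<Rightarrow> real) \<Rightarrow>
   source \<Rightarrow> 'w set set" where
  "source_events M W Y X \<Psi> Signal = sets (vimage_algebra (space M) W borel)"
| "source_events M W Y X \<Psi> Self_Interference = sets (vimage_algebra (space M) Y borel)"
| "source_events M W Y X \<Psi> Points =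
     sets (vimage_algebra (space M) (\<lambda>\<omega> l. X l \<omega>) (Pi\<^sub>M UNIV (\<lambda>_. borel)))"
| "source_events M W Y X \<Psi> (Mark l) = sets (vimage_algebra (space M) (\<Psi> l) borel)"

definition mutually_independent ::
  "'w measure \<Rightarrow> ('w \<Rightarrow> real) \<Rightarrow> ('w \<Rightarrow> real) \<Rightarrow> (nat \<Rightarrow> 'w \<Rightarrow> real^2) \<Rightarrow> (nat \<Rightarrow> 'w \<Rightarrow> real) \<Rightarrow>
   bool" where
  "mutually_independent M W Y X \<Psi> \<longleftrightarrow>
     prob_space.indep_sets M (source_events M W Y X \<Psi>) UNIV"

definition sinr ::
  "real \<Rightarrow> ('w \<Rightarrow> real) \<Rightarrow> ('w \<Rightarrow> real) \<Rightarrow> (nat \<Rightarrow> 'w \<Rightarrow> real^2) \<Rightarrow> (nat \<Rightarrow> 'w \<Rightarrow> real) \<Rightarrow>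
   'w \<Rightarrow> real" where
  "sinr \<alpha> W Y X \<Psi> \<omega> = W \<omega> / (Y \<omega> + (\<Sum>l. norm (X l \<omega>) powr (- \<alpha>) * \<Psi> l \<omega>) + 1)"

definition outage_probability :: "'w measure \<Rightarrow> ('w \<Rightarrow> real) \<Rightarrow> real \<Rightarrow> real" where
  "outage_probability M \<gamma> \<beta> = measure M {\<omega> \<in> space M. \<gamma> \<omega> \<le> \<beta>}"

definition single_user_outage ::
  "'w measure \<Rightarrow> ('w \<Rightarrow> real) \<Rightarrow> ('w \<Rightarrow> real) \<Rightarrow> real \<Rightarrow> real" where
  "single_user_outage M W Y \<beta> = outage_probability M (\<lambda>\<omega>. W \<omega> / (Y \<omega> + 1)) \<beta>"

text \<open>\<open>F\<close> is the outage probability as a function of the intensity \<open>\<mu> > 0\<close>, \<open>F0\<close> its value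
  without interferers. At \<open>\<epsilon> = F0\<close> the intensity is 0. Note that the success
  probability \<open>1 - \<epsilon>\<close> contributes to the leading order of the capacity at \<open>\<epsilon> = F0\<close>, because
  it tends to \<open>1 - F0\<close> there and \<open>F0 > 0\<close>.\<close>

definition contention_density :: "(real \<Rightarrow> real) \<Rightarrow> real \<Rightarrow> real" where
  "contention_density F \<epsilon> = the_inv_into {0<..} F \<epsilon>"

definition transmission_capacity :: "real \<Rightarrow> real \<Rightarrow> (real \<Rightarrow> real) \<Rightarrow> real \<Rightarrow> real" where
  "transmission_capacity \<zeta> F0 F \<epsilon> =
     (if \<epsilon> \<le> F0 then 0 else \<zeta> * contention_density F \<epsilon> * (1 - \<epsilon>))"

definition pos_part :: "real \<Rightarrow> real" where
  "pos_part a = max a 0"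

definition damped_moment :: "'w measure \<Rightarrow> ('w \<Rightarrow> real) \<Rightarrow> real \<Rightarrow> real \<Rightarrow> nat \<Rightarrow> real" where
  "damped_moment M Y \<beta> \<theta> \<tau> = (LINT \<omega>|M. exp (- (\<beta> * Y \<omega> / \<theta>)) * Y \<omega> ^ \<tau>)"

definition interference_factor ::
  "'w measure \<Rightarrow> ('w \<Rightarrow> real) \<Rightarrow> real \<Rightarrow> real \<Rightarrow> real \<Rightarrow> nat \<Rightarrow> real" where
  "interference_factor M Y \<alpha> \<beta> \<theta> m =
     (LINT \<omega>|M. exp (- (\<beta> * (Y \<omega> + 1) / \<theta>)) *
        kummer_1F1 (1 - real m) (1 + 2 / \<alpha> - real m) (\<beta> * (Y \<omega> + 1) / \<theta>))"

end

theory Submission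
  imports Defs
begin

text \<open>
  The Laplace functional of the Poisson process gives the interference at intensity \<open>\<mu>\<close> a
  one-sided stable law, \<open>E exp (- t I) = exp (- \<mu> C t powr d)\<close> with \<open>d = 2 / \<alpha>\<close>. Letting \<open>t\<close> tend to 0
  shows that \<open>I\<close> is finite almost surely, and differentiating \<open>k\<close> times in \<open>t\<close> gives
  \<open>E (I ^ k * exp (- t I))\<close>. Since \<open>W\<close> has an integer shape, its survival function is a sum of terms
  \<open>x ^ k * exp (- x) / k!\<close>, so the success probability at intensity \<open>\<mu>\<close> is \<open>exp (- x)\<close> times a
  polynomial in \<open>x = \<mu> C (\<beta> / \<theta>) powr d\<close>. Its value at 0 is the single-user success probability, its
  slope at 0 determines the leading coefficient of the capacity, and it is strictly smaller than its
  value at 0 elsewhere and vanishes at infinity. Hence for \<open>\<epsilon>\<close> slightly above the single-user outage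
  the contention density is unique and is given by Taylor expansion up to a quadratic error.
\<close>

section \<open>Laplace functional of a Poisson process\<close>

text \<open>The real series in \<open>sinr\<close> has a meaningful value only where it converges,
  and its convergence is itself read off from the Laplace transform; hence the detour through
  extended numbers. Averaging the marks with the points held fixed leaves a functional of the points
  alone. The power \<open>t powr d\<close> comes from scaling: a factor in \<open>t\<close> enlarges
  the radii of the level sets of the path loss by its power \<open>1 / \<alpha>\<close>, hence their
  areas by its power \<open>d\<close>. The assumption \<open>\<alpha> > 2\<close> gives
  \<open>d < 1\<close>, so that \<open>Gamma (1 - d)\<close> is a convergent integral. This factor
  of \<open>C\<close> cancels at the end: the slope of the success probability at 0 contains its
  reciprocal, through partial sums of the coefficients of \<open>(1 - z) powr d\<close>, and what
  remains is the terminating Kummer sum. The polynomial does not show that the success probability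
  is strictly below its value at 0; that inequality is taken from the probabilistic meaning instead.
  Since \<open>contention_density\<close> is a definite description over all positive intensities,
  uniqueness also needs this control far from 0.\<close>

text \<open>The exponential is extended to infinite arguments because the interference is only known to be
  an extended nonnegative number before its Laplace transform has been computed.\<close>

definition exp_neg :: "ennreal \<Rightarrow> real" where
  "exp_neg x = (if x = top then 0 else exp (- enn2real x))"

lemma exp_neg_ennreal [simp]: "0 \<le> r \<Longrightarrow> exp_neg (ennreal r) = exp (- r)"
  by (simp add: exp_neg_def)

lemma exp_neg_top [simp]: "exp_neg top = 0"
  by (simp add: exp_neg_def)

lemma exp_neg_0 [simp]: "exp_neg 0 = 1"
  by (simp add: exp_neg_def)

lemma exp_neg_nonneg [simp]: "0 \<le> exp_neg x"
  by (simp add: exp_neg_def)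

lemma exp_neg_le_1 [simp]: "exp_neg x \<le> 1"
  by (simp add: exp_neg_def)

lemma exp_neg_add: "exp_neg (x + y) = exp_neg x * exp_neg y"
  by (cases x; cases y) (auto simp: exp_add[symmetric] simp flip: ennreal_plus)

lemma exp_neg_sum: "finite I \<Longrightarrow> exp_neg (\<Sum>i\<in>I. f i) = (\<Prod>i\<in>I. exp_neg (f i))"
  by (induction I rule: finite_induct) (auto simp: exp_neg_add)

lemma exp_neg_antimono: "x \<le> y \<Longrightarrow> exp_neg y \<le> exp_neg x"
  by (cases x; cases y) (auto simp: top_unique)

text \<open>Continuity includes the point \<open>top\<close>, so partial sums and monotone
  approximations can be passed to the limit even where the limit sum diverges.\<close>

lemma tendsto_exp_neg:
  assumes "(f \<longlongrightarrow> x) F"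
  shows "((\<lambda>i. exp_neg (f i)) \<longlongrightarrow> exp_neg x) F"
proof (cases x)
  case (real r)
  have "eventually (\<lambda>i. f i < top) F"
    using assms real by (intro order_tendstoD(2)) auto
  moreover have "((\<lambda>i. exp (- enn2real (f i))) \<longlongrightarrow> exp (- r)) F"
    using assms real by (intro tendsto_intros) auto
  ultimately show ?thesis
    using real by (auto simp: exp_neg_def elim!: Lim_transform_eventually eventually_mono)
next
  case top
  show ?thesis
  proof (rule tendstoI)
    fix e :: real assume "0 < e"
    define r where "r = max 0 (- ln e)"
    have r_nonneg: "0 \<le> r"
      by (simp add: r_def)
    have "eventually (\<lambda>i. ennreal r < f i) F"
      using assms top by (intro order_tendstoD(1)) auto
    then show "eventually (\<lambda>i. dist (exp_neg (f i)) (exp_neg x) < e) F"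
    proof eventually_elim
      case (elim i)
      show ?case
      proof (cases "f i")
        case (real q)
        then have "r < q"
          using elim by (simp add: ennreal_less_iff r_nonneg)
        then have "- q < ln e"
          by (simp add: r_def)
        then have "exp (- q) < e"
          using \<open>0 < e\<close> by (metis exp_less_cancel_iff exp_ln)
        then show ?thesis
          using real top by simp
      qed (use \<open>0 < e\<close> top in simp)
    qed
  qed
qed

lemma continuous_on_exp_neg: "continuous_on A exp_neg"
  unfolding continuous_on_def by (auto intro!: tendsto_exp_neg)

lemma measurable_exp_neg [measurable]: "exp_neg \<in> borel_measurable borel"
  by (rule borel_measurable_continuous_onI[OF continuous_on_exp_neg])

section \<open>Counts of a Poisson process in bounded sets\<close>

lemma emeasure_bounded_lborel:
  "B \<in> sets borel \<Longrightarrow> bounded B \<Longrightarrow> emeasure lborel B = ennreal (measure lborel B)"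
  using emeasure_bounded_finite[of B] by (simp add: emeasure_eq_ennreal_measure)

lemma PPP_points_measurable:
  "homogeneous_PPP M \<mu> X \<Longrightarrow> X l \<in> borel_measurable M"
  by (simp add: homogeneous_PPP_def)

lemma sets_finite_points:
  fixes X :: "nat \<Rightarrow> 'w \<Rightarrow> real^2"
  assumes [measurable]: "\<And>l. X l \<in> borel_measurable M" "B \<in> sets borel"
  shows "{\<omega> \<in> space M. finite {l. X l \<omega> \<in> B}} \<in> sets M"
proof -
  have "{\<omega> \<in> space M. finite {l. X l \<omega> \<in> B}} =
      (\<Union>n. {\<omega> \<in> space M. \<forall>l. X l \<omega> \<in> B \<longrightarrow> l \<le> n})"
    by (auto simp: finite_nat_set_iff_bounded_le)
  also have "\<dots> \<in> sets M"
    by measurable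
  finally show ?thesis .
qed

text \<open>\<open>homogeneous_PPP\<close> gives measurability of counts only as part of the
  independence of a disjoint family, so \<open>B\<close> is padded with empty sets to form
  one.\<close>

lemma (in prob_space) PPP_counts_measurable:
  assumes "homogeneous_PPP M \<mu> X" "B \<in> sets borel" "bounded B"
  shows "point_count X B \<in> measurable M (count_space UNIV)"
proof -
  define C where "C = (\<lambda>j::nat. if j = 0 then B else {})"
  have "\<forall>j. C j \<in> sets borel \<and> bounded (C j)" "disjoint_family C"
    using assms by (auto simp: C_def disjoint_family_on_def)
  then have "indep_vars (\<lambda>_. count_space UNIV) (\<lambda>j. point_count X (C j)) UNIV"
    using assms(1) unfolding homogeneous_PPP_def by blast
  then have "point_count X (C 0) \<in> measurable M (count_space UNIV)"
    unfolding indep_vars_def by blast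
  then show ?thesis
    by (simp add: C_def)
qed

lemma suminf_poisson:
  fixes r c :: real
  assumes "0 \<le> r"
  shows "(\<Sum>k. ennreal (exp (- c * real k) * (r ^ k / fact k * exp (- r)))) =
    ennreal (exp (- (r * (1 - exp (- c)))))"
proof -
  have "(\<lambda>k. exp (- r) * ((r * exp (- c)) ^ k /\<^sub>R fact k)) sums (exp (- r) * exp (r * exp (- c)))"
    by (intro sums_mult exp_converges)
  also have "(\<lambda>k. exp (- r) * ((r * exp (- c)) ^ k /\<^sub>R fact k)) =
      (\<lambda>k. exp (- c * real k) * (r ^ k / fact k * exp (- r)))"
    by (auto simp: power_mult_distrib exp_of_nat_mult[symmetric] field_simps)
  also have "exp (- r) * exp (r * exp (- c)) = exp (- (r * (1 - exp (- c))))"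
    by (simp add: exp_add[symmetric] algebra_simps)
  finally show ?thesis
    using assms by (intro suminf_ennreal_eq) auto
qed

text \<open>The events \<open>A k\<close> demand finiteness together with the value
  \<open>k\<close>, so an infinite set of points, whose \<open>card\<close> is 0, does not count
  towards \<open>A 0\<close>. The Poisson weights of these events sum to 1, which is the case
  \<open>c = 0\<close> of the integral, and this forces almost sure finiteness.\<close>

lemma (in prob_space)
  assumes ppp: "homogeneous_PPP M \<mu> X" and "0 \<le> \<mu>" and B: "B \<in> sets borel" "bounded B"
  shows AE_PPP_finite: "AE \<omega> in M. finite {l. X l \<omega> \<in> B}"
    and nn_integral_exp_PPP_count: "(\<integral>\<^sup>+\<omega>. ennreal (exp (- c * real (point_count X B \<omega>))) \<partial>M) =
      ennreal (exp (- (\<mu> * measure lborel B * (1 - exp (- c)))))"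
proof -
  define N where "N = point_count X B"
  define r where "r = \<mu> * measure lborel B"
  have "0 \<le> r"
    using \<open>0 \<le> \<mu>\<close> by (simp add: r_def)
  have [measurable]: "N \<in> measurable M (count_space UNIV)" "\<And>l. X l \<in> borel_measurable M"
    using PPP_counts_measurable[OF ppp B] PPP_points_measurable[OF ppp] by (auto simp: N_def)
  define Fin where "Fin = {\<omega> \<in> space M. finite {l. X l \<omega> \<in> B}}"
  have Fin_sets [measurable]: "Fin \<in> sets M"
    unfolding Fin_def using B by (intro sets_finite_points) auto
  define A where "A = (\<lambda>k. {\<omega> \<in> space M. finite {l. X l \<omega> \<in> B} \<and> N \<omega> = k})"
  have A_sets [measurable]: "A k \<in> sets M" for k
  proof -
    have "A k = Fin \<inter> {\<omega> \<in> space M. N \<omega> = k}"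
      by (auto simp: A_def Fin_def)
    then show ?thesis by simp
  qed
  have A: "emeasure M (A k) = ennreal (r ^ k / fact k * exp (- r))" for k
    using ppp B unfolding homogeneous_PPP_def A_def N_def r_def emeasure_eq_measure by auto
  have sum_A: "(\<Sum>k. ennreal (exp (- c * real k)) * indicator (A k) \<omega>) =
      ennreal (exp (- c * real (N \<omega>))) * indicator Fin \<omega>" if "\<omega> \<in> space M" for \<omega> c
  proof -
    have "(\<lambda>k. ennreal (exp (- c * real k)) * indicator (A k) \<omega>) =
        (\<lambda>k. if k = N \<omega> then ennreal (exp (- c * real (N \<omega>))) * indicator Fin \<omega> else 0)"
      using that by (auto simp: A_def Fin_def indicator_def)
    then show ?thesis
      by (cases "\<omega> \<in> Fin"; simp only:) (subst suminf_finite[where N="{N \<omega>}"]; simp)+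
  qed
  have int: "(\<integral>\<^sup>+\<omega>. ennreal (exp (- c * real (N \<omega>))) * indicator Fin \<omega> \<partial>M) =
      ennreal (exp (- (r * (1 - exp (- c)))))" for c
  proof -
    have "(\<integral>\<^sup>+\<omega>. ennreal (exp (- c * real (N \<omega>))) * indicator Fin \<omega> \<partial>M) =
        (\<integral>\<^sup>+\<omega>. (\<Sum>k. ennreal (exp (- c * real k)) * indicator (A k) \<omega>) \<partial>M)"
      using sum_A by (intro nn_integral_cong) simp
    also have "\<dots> = (\<Sum>k. \<integral>\<^sup>+\<omega>. ennreal (exp (- c * real k)) * indicator (A k) \<omega> \<partial>M)"
      by (intro nn_integral_suminf) measurable
    also have "\<dots> = (\<Sum>k. ennreal (exp (- c * real k) * (r ^ k / fact k * exp (- r))))"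
      using \<open>0 \<le> r\<close> by (simp add: nn_integral_cmult_indicator A ennreal_mult[symmetric])
    finally show ?thesis
      by (simp only: suminf_poisson[OF \<open>0 \<le> r\<close>])
  qed
  have "emeasure M Fin = 1"
    using int[of 0] by simp
  then have "prob Fin = 1"
    by (simp add: emeasure_eq_measure)
  then have AE: "AE \<omega> in M. \<omega> \<in> Fin"
    by (simp add: prob_eq_1)
  then show "AE \<omega> in M. finite {l. X l \<omega> \<in> B}"
    by eventually_elim (simp add: Fin_def)
  have "(\<integral>\<^sup>+\<omega>. ennreal (exp (- c * real (N \<omega>))) \<partial>M) =
      (\<integral>\<^sup>+\<omega>. ennreal (exp (- c * real (N \<omega>))) * indicator Fin \<omega> \<partial>M)"
    using AE by (intro nn_integral_cong_AE) (auto elim!: eventually_mono)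
  with int show "(\<integral>\<^sup>+\<omega>. ennreal (exp (- c * real (point_count X B \<omega>))) \<partial>M) =
      ennreal (exp (- (\<mu> * measure lborel B * (1 - exp (- c)))))"
    by (simp only: N_def r_def)
qed

lemma suminf_indicator_points:
  assumes "finite {l. X l \<omega> \<in> B}"
  shows "(\<Sum>l. ennreal c * indicator B (X l \<omega>)) = ennreal c * of_nat (point_count X B \<omega>)"
proof -
  have "(\<Sum>l. ennreal c * indicator B (X l \<omega>)) =
      (\<Sum>l\<in>{l. X l \<omega> \<in> B}. ennreal c * indicator B (X l \<omega>))"
    using assms by (intro suminf_finite) auto
  also have "\<dots> = (\<Sum>l\<in>{l. X l \<omega> \<in> B}. ennreal c)"
    by (intro sum.cong) auto
  finally show ?thesis
    by (simp add: point_count_def mult.commute)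
qed

text \<open>For a step function on disjoint bounded pieces the sum over the points is a combination
  of independent Poisson counts, so the transform is a product of Poisson transforms. At each
  \<open>x\<close> at most one indicator is nonzero, which is why the exponents add up to the
  integral of \<open>1 - exp_neg (f x)\<close>.\<close>

lemma (in prob_space) PPP_laplace_step:
  fixes B :: "nat \<Rightarrow> (real^2) set" and c :: "nat \<Rightarrow> real"
  assumes ppp: "homogeneous_PPP M \<mu> X" and "0 \<le> \<mu>"
    and B: "\<And>j. B j \<in> sets borel" "\<And>j. bounded (B j)" "disjoint_family B"
    and c: "\<And>j. 0 \<le> c j"
    and f: "\<And>x. f x = (\<Sum>j<K. ennreal (c j) * indicator (B j) x)"
  shows "(\<integral>\<^sup>+\<omega>. ennreal (exp_neg (\<Sum>l. f (X l \<omega>))) \<partial>M) =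
    ennreal (exp_neg (ennreal \<mu> * (\<integral>\<^sup>+x. ennreal (1 - exp_neg (f x)) \<partial>lborel)))"
proof -
  define N where "N = (\<lambda>j. point_count X (B j))"
  have nonneg: "0 \<le> (\<Sum>j<K. (1 - exp (- c j)) * measure lborel (B j))"
    using c by (intro sum_nonneg mult_nonneg_nonneg) auto
  have "AE \<omega> in M. \<forall>j\<in>{..<K}. finite {l. X l \<omega> \<in> B j}"
    using AE_PPP_finite[OF ppp \<open>0 \<le> \<mu>\<close> B(1,2)] by (intro AE_finite_allI) auto
  then have AE: "AE \<omega> in M. exp_neg (\<Sum>l. f (X l \<omega>)) = (\<Prod>j<K. exp (- c j * real (N j \<omega>)))"
  proof eventually_elim
    case (elim \<omega>)
    have "(\<Sum>l. f (X l \<omega>)) = (\<Sum>j<K. \<Sum>l. ennreal (c j) * indicator (B j) (X l \<omega>))"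
      unfolding f by (intro suminf_sum) auto
    also have "\<dots> = (\<Sum>j<K. ennreal (c j * real (N j \<omega>)))"
      using elim c by (intro sum.cong refl)
        (simp add: suminf_indicator_points N_def ennreal_mult ennreal_of_nat_eq_real_of_nat
          del: ennreal_suminf_cmult)
    finally show ?case
      using c by (simp add: exp_neg_sum del: sum_ennreal)
  qed
  have indep: "indep_vars (\<lambda>_. count_space UNIV) N {..<K}"
  proof -
    have "indep_vars (\<lambda>_. count_space UNIV) N UNIV"
      using ppp B unfolding homogeneous_PPP_def N_def by blast
    then show ?thesis
      by (rule indep_vars_subset) auto
  qed
  have "(\<integral>\<^sup>+\<omega>. ennreal (exp_neg (\<Sum>l. f (X l \<omega>))) \<partial>M) =
      (\<integral>\<^sup>+\<omega>. (\<Prod>j<K. ennreal (exp (- c j * real (N j \<omega>)))) \<partial>M)"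
    using AE by (intro nn_integral_cong_AE) (auto elim!: eventually_mono simp: prod_ennreal)
  also have "\<dots> = (\<Prod>j<K. \<integral>\<^sup>+\<omega>. ennreal (exp (- c j * real (N j \<omega>))) \<partial>M)"
    by (intro indep_vars_nn_integral indep_vars_compose2[OF indep]) auto
  also have "\<dots> = (\<Prod>j<K. ennreal (exp (- (\<mu> * measure lborel (B j) * (1 - exp (- c j))))))"
    unfolding N_def by (intro prod.cong refl nn_integral_exp_PPP_count[OF ppp \<open>0 \<le> \<mu>\<close>] B)
  also have "\<dots> = ennreal (exp (- (\<Sum>j<K. \<mu> * measure lborel (B j) * (1 - exp (- c j)))))"
    by (simp add: prod_ennreal exp_sum sum_negf[symmetric])
  also have "(\<Sum>j<K. \<mu> * measure lborel (B j) * (1 - exp (- c j))) =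
      \<mu> * (\<Sum>j<K. (1 - exp (- c j)) * measure lborel (B j))"
    by (simp add: sum_distrib_left mult_ac)
  also have "ennreal (exp (- (\<mu> * (\<Sum>j<K. (1 - exp (- c j)) * measure lborel (B j))))) =
      ennreal (exp_neg (ennreal \<mu> * ennreal (\<Sum>j<K. (1 - exp (- c j)) * measure lborel (B j))))"
    using nonneg \<open>0 \<le> \<mu>\<close> by (simp add: ennreal_mult[symmetric] del: sum_ennreal)
  also have "ennreal (\<Sum>j<K. (1 - exp (- c j)) * measure lborel (B j)) =
      (\<Sum>j<K. ennreal (1 - exp (- c j)) * emeasure lborel (B j))"
    using c B by (simp add: sum_ennreal[symmetric] ennreal_mult emeasure_bounded_lborel)
  also have "\<dots> = (\<integral>\<^sup>+x. (\<Sum>j<K. ennreal (1 - exp (- c j)) * indicator (B j) x) \<partial>lborel)"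
    using B by (subst nn_integral_sum) (auto simp: nn_integral_cmult_indicator)
  also have "\<dots> = (\<integral>\<^sup>+x. ennreal (1 - exp_neg (f x)) \<partial>lborel)"
  proof (intro nn_integral_cong)
    fix x :: "real^2"
    show "(\<Sum>j<K. ennreal (1 - exp (- c j)) * indicator (B j) x) = ennreal (1 - exp_neg (f x))"
    proof (cases "\<exists>j<K. x \<in> B j")
      case True
      then obtain j where j: "j < K" "x \<in> B j" by blast
      have "disjoint_family_on B {..<K}"
        using B(3) by (auto simp: disjoint_family_on_def)
      then have single: "(\<Sum>i<K. F i * indicator (B i) x) = F j" for F :: "nat \<Rightarrow> ennreal"
        using j by (intro sum_indicator_disjoint_family) auto
      show ?thesis
        using c by (simp only: f single) simp
    next
      case False
      then show ?thesis
        by (simp add: f)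
    qed
  qed
  finally show ?thesis .
qed

text \<open>Increasing approximation by step functions: the left side converges by domination with
  the constant 1, the exponent on the right by monotone convergence.\<close>

lemma (in prob_space) PPP_laplace_functional:
  fixes f :: "real^2 \<Rightarrow> ennreal"
  assumes ppp: "homogeneous_PPP M \<mu> X" and "0 \<le> \<mu>" and f [measurable]: "f \<in> borel_measurable borel"
  shows "(\<integral>\<^sup>+\<omega>. ennreal (exp_neg (\<Sum>l. f (X l \<omega>))) \<partial>M) =
    ennreal (exp_neg (ennreal \<mu> * (\<integral>\<^sup>+x. ennreal (1 - exp_neg (f x)) \<partial>lborel)))"
proof -
  obtain g :: "nat \<Rightarrow> real^2 \<Rightarrow> ennreal" where g: "\<And>i. simple_function borel (g i)" "incseq g"
    "\<And>i x. g i x < top" "\<And>x. (SUP i. g i x) = f x"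
    using borel_measurable_implies_simple_function_sequence'[OF f] by metis
  \<comment> \<open>The cut-off to growing balls makes the level sets bounded;
    \<open>homogeneous_PPP\<close> prescribes counts on bounded sets only.\<close>
  define h where "h = (\<lambda>i x. g i x * indicator (ball 0 (real i)) x)"
  have [measurable]: "\<And>l. X l \<in> borel_measurable M"
    using PPP_points_measurable[OF ppp] .
  have g_meas [measurable]: "g i \<in> borel_measurable borel" for i
    using g(1) by (rule borel_measurable_simple_function)
  have h_meas [measurable]: "h i \<in> borel_measurable borel" for i
    unfolding h_def by (intro borel_measurable_times_ennreal g_meas borel_measurable_indicator) simp
  have h_mono: "incseq (\<lambda>i. h i x)" for x
  proof (rule incseq_SucI)
    fix i
    have "g i x \<le> g (Suc i) x"
      using g(2) by (auto simp: incseq_Suc_iff le_fun_def)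
    then show "h i x \<le> h (Suc i) x"
      by (auto simp: h_def indicator_def)
  qed
  have h_lim: "(\<lambda>i. h i x) \<longlonglongrightarrow> f x" for x
  proof -
    have "incseq (\<lambda>i. g i x)"
      using g(2) by (auto simp: mono_def le_fun_def)
    then have "(\<lambda>i. g i x) \<longlonglongrightarrow> f x"
      using LIMSEQ_SUP g(4) by metis
    moreover have "eventually (\<lambda>i. g i x = h i x) sequentially"
    proof -
      obtain n where "norm x < real n"
        using reals_Archimedean2 by blast
      then have "eventually (\<lambda>i. norm x < real i) sequentially"
        by (intro eventually_sequentiallyI[of n]) auto
      then show ?thesis
        by eventually_elim (simp add: h_def)
    qed
    ultimately show ?thesis
      by (rule Lim_transform_eventually)
  qed
  have step: "(\<integral>\<^sup>+\<omega>. ennreal (exp_neg (\<Sum>l. h i (X l \<omega>))) \<partial>M) =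
    ennreal (exp_neg (ennreal \<mu> * (\<integral>\<^sup>+x. ennreal (1 - exp_neg (h i x)) \<partial>lborel)))" for i
  proof -
    have fin: "finite (range (g i))"
      using g(1)[of i] by (simp add: simple_function_def)
    obtain e :: "nat \<Rightarrow> ennreal" where e: "bij_betw e {0..<card (range (g i))} (range (g i))"
      using ex_bij_betw_nat_finite[OF fin] by blast
    define K where "K = card (range (g i))"
    \<comment> \<open>Beyond \<open>K\<close> the family consists of empty sets, because
      independence of counts is stated for families indexed by all naturals.\<close>
    define B where "B = (\<lambda>j. if j < K then g i -` {e j} \<inter> ball 0 (real i) else {})"
    show ?thesis
    proof (rule PPP_laplace_step[OF ppp \<open>0 \<le> \<mu>\<close>])
      show "B j \<in> sets borel" for j
        using measurable_sets[OF g_meas, of "{e j}" i] by (simp add: B_def sets.Int)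
      show "bounded (B j)" for j
        by (simp add: B_def bounded_Int)
      show "disjoint_family B"
      proof (unfold disjoint_family_on_def, intro ballI impI)
        fix j k :: nat assume "j \<noteq> k"
        then have "e j \<noteq> e k" if "j < K" "k < K"
          using e that by (auto simp: bij_betw_def K_def dest: inj_onD)
        then show "B j \<inter> B k = {}"
          by (auto simp: B_def)
      qed
      show "0 \<le> enn2real (e j)" for j
        by simp
      show "h i x = (\<Sum>j<K. ennreal (enn2real (e j)) * indicator (B j) x)" for x
      proof -
        have "g i x = (\<Sum>y\<in>range (g i). y * indicator (g i -` {y}) x)"
          using simple_function_indicator_representation[OF g(1), of x i]
          by (simp only: space_borel UNIV_I Int_UNIV_right simp_thms)
        also have "\<dots> = (\<Sum>j<K. e j * indicator (g i -` {e j}) x)"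
          using sum.reindex_bij_betw[OF e, of "\<lambda>y. y * indicator (g i -` {y}) x"]
          by (simp add: K_def atLeast0LessThan)
        finally have "h i x = (\<Sum>j<K. e j * indicator (g i -` {e j}) x) * indicator (ball 0 (real i)) x"
          by (simp only: h_def)
        also have "\<dots> = (\<Sum>j<K. e j * indicator (B j) x)"
          unfolding sum_distrib_right B_def by (intro sum.cong refl) (simp add: indicator_def)
        also have "\<dots> = (\<Sum>j<K. ennreal (enn2real (e j)) * indicator (B j) x)"
        proof (intro sum.cong refl)
          fix j assume "j \<in> {..<K}"
          then have "e j \<in> range (g i)"
            using e unfolding bij_betw_def K_def by auto
          then have "e j < top"
            using g(3) by auto
          then show "e j * indicator (B j) x = ennreal (enn2real (e j)) * indicator (B j) x"
            by simp
        qed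
        finally show ?thesis .
      qed
    qed
  qed
  have "(\<lambda>i. \<integral>\<^sup>+\<omega>. ennreal (exp_neg (\<Sum>l. h i (X l \<omega>))) \<partial>M) \<longlonglongrightarrow>
      (\<integral>\<^sup>+\<omega>. ennreal (exp_neg (\<Sum>l. f (X l \<omega>))) \<partial>M)"
  proof (rule nn_integral_dominated_convergence[where w="\<lambda>_. 1"])
    show "AE \<omega> in M. (\<lambda>i. ennreal (exp_neg (\<Sum>l. h i (X l \<omega>)))) \<longlonglongrightarrow>
        ennreal (exp_neg (\<Sum>l. f (X l \<omega>)))"
    proof (intro AE_I2 tendsto_ennrealI tendsto_exp_neg)
      fix \<omega>
      have "(\<Sum>l. f (X l \<omega>)) = (SUP i. \<Sum>l. h i (X l \<omega>))"
        using ennreal_suminf_SUP_eq[OF h_mono] LIMSEQ_unique[OF h_lim LIMSEQ_SUP[OF h_mono]]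
        by simp
      moreover have "incseq (\<lambda>i. \<Sum>l. h i (X l \<omega>))"
        using h_mono by (auto simp: mono_def intro!: suminf_le)
      ultimately show "(\<lambda>i. \<Sum>l. h i (X l \<omega>)) \<longlonglongrightarrow> (\<Sum>l. f (X l \<omega>))"
        using LIMSEQ_SUP by metis
    qed
  qed (auto simp: emeasure_space_1 intro!: AE_I2 ennreal_le_1[THEN iffD2])
  moreover have "(\<lambda>i. ennreal (exp_neg (ennreal \<mu> * (\<integral>\<^sup>+x. ennreal (1 - exp_neg (h i x)) \<partial>lborel)))) \<longlonglongrightarrow>
      ennreal (exp_neg (ennreal \<mu> * (\<integral>\<^sup>+x. ennreal (1 - exp_neg (f x)) \<partial>lborel)))"
  proof -
    have "(\<lambda>i. \<integral>\<^sup>+x. ennreal (1 - exp_neg (h i x)) \<partial>lborel) \<longlonglongrightarrow>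
        (\<integral>\<^sup>+x. ennreal (1 - exp_neg (f x)) \<partial>lborel)"
    proof (rule nn_integral_LIMSEQ)
      show "incseq (\<lambda>i x. ennreal (1 - exp_neg (h i x)))"
        using h_mono by (auto simp: mono_def le_fun_def intro!: ennreal_leI exp_neg_antimono)
      show "(\<lambda>i. ennreal (1 - exp_neg (h i x))) \<longlonglongrightarrow> ennreal (1 - exp_neg (f x))" for x
        by (intro tendsto_ennrealI tendsto_intros tendsto_exp_neg h_lim)
    qed measurable
    then show ?thesis
      by (intro tendsto_ennrealI tendsto_exp_neg ennreal_tendsto_cmult) auto
  qed
  ultimately show ?thesis
    unfolding step by (rule LIMSEQ_unique)
qed

section \<open>Gamma distribution and planar path loss\<close>

lemma nn_integral_powr_exp:
  fixes a b :: real
  assumes "0 < a" "0 < b"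
  shows "(\<integral>\<^sup>+t. ennreal (indicator {0<..} t * (t powr (a - 1) * exp (- (b * t)))) \<partial>lborel) =
    ennreal (Gamma a * b powr (- a))"
proof -
  define f where "f = (\<lambda>t::real. ennreal (indicator {0..} t * t powr (a - 1) / exp t))"
  have "ennreal (Gamma a) = (\<integral>\<^sup>+t. f t \<partial>lborel)"
    unfolding f_def by (rule Gamma_conv_nn_integral_real) fact
  also have "\<dots> = ennreal b * (\<integral>\<^sup>+t. f (0 + b * t) \<partial>lborel)"
    using \<open>0 < b\<close> by (subst nn_integral_real_affine[of f b 0]) (auto simp: f_def)
  also have "(\<integral>\<^sup>+t. f (0 + b * t) \<partial>lborel) =
      (\<integral>\<^sup>+t. ennreal (b powr (a - 1)) *
        ennreal (indicator {0<..} t * (t powr (a - 1) * exp (- (b * t)))) \<partial>lborel)"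
    using assms unfolding f_def
    by (intro nn_integral_cong)
      (auto simp: indicator_def powr_mult exp_minus divide_inverse zero_le_mult_iff
        ennreal_mult[symmetric] mult_ac)
  also have "\<dots> = ennreal (b powr (a - 1)) *
      (\<integral>\<^sup>+t. ennreal (indicator {0<..} t * (t powr (a - 1) * exp (- (b * t)))) \<partial>lborel)"
    by (intro nn_integral_cmult) measurable
  also have "ennreal b * \<dots> = ennreal (b powr a) *
      (\<integral>\<^sup>+t. ennreal (indicator {0<..} t * (t powr (a - 1) * exp (- (b * t)))) \<partial>lborel)"
    using assms by (simp add: mult.assoc[symmetric] ennreal_mult[symmetric] powr_mult_base)
  finally have eq: "ennreal (Gamma a) = ennreal (b powr a) *
      (\<integral>\<^sup>+t. ennreal (indicator {0<..} t * (t powr (a - 1) * exp (- (b * t)))) \<partial>lborel)" .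
  have "ennreal (Gamma a * b powr (- a)) = ennreal (b powr (- a)) * ennreal (Gamma a)"
    using assms by (simp add: ennreal_mult mult.commute)
  also have "\<dots> = ennreal (b powr (- a) * b powr a) *
      (\<integral>\<^sup>+t. ennreal (indicator {0<..} t * (t powr (a - 1) * exp (- (b * t)))) \<partial>lborel)"
    unfolding eq by (simp add: mult.assoc[symmetric] ennreal_mult)
  also have "b powr (- a) * b powr a = 1"
    using assms by (simp add: powr_minus)
  finally show ?thesis by simp
qed

lemma measurable_gamma_density [measurable]: "gamma_density v s \<in> borel_measurable borel"
  unfolding gamma_density_def[abs_def] by measurable

lemma gamma_distributed_measurable: "gamma_distributed M Z v s \<Longrightarrow> Z \<in> borel_measurable M"
  by (auto simp: gamma_distributed_def distributed_def)

lemma gamma_distributed_AE_pos: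
  assumes "gamma_distributed M Z v s"
  shows "AE \<omega> in M. 0 < Z \<omega>"
proof -
  have D: "distributed M lborel Z (\<lambda>x. ennreal (gamma_density v s x))"
    using assms by (simp add: gamma_distributed_def)
  have "AE x in density lborel (\<lambda>x. ennreal (gamma_density v s x)). 0 < x"
    by (subst AE_density) (auto simp: gamma_density_def)
  then have "AE x in distr M lborel Z. 0 < x"
    by (simp only: distributed_distr_eq_density[OF D])
  then show ?thesis
    by (rule AE_distrD[rotated]) (use D in \<open>auto simp: distributed_def\<close>)
qed

text \<open>Tilting a gamma density by \<open>x powr a * exp (- (b * x))\<close> gives a multiple of
  another gamma density. The one formula serves for the Laplace transform of a mark
  (\<open>a = 0\<close>), its moment of order \<open>2 / \<alpha>\<close> (\<open>b = 0\<close>) and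
  the damped moments of \<open>Y\<close>.\<close>

lemma gamma_distributed_moment:
  assumes Z: "gamma_distributed M Z v s" and "0 < v" "0 < s" "0 < v + a" "0 < b + 1 / s"
  shows "(\<integral>\<^sup>+\<omega>. ennreal (Z \<omega> powr a * exp (- (b * Z \<omega>))) \<partial>M) =
    ennreal (Gamma (v + a) / (Gamma v * s powr v) * (b + 1 / s) powr (- a - v))"
proof -
  have "(\<integral>\<^sup>+\<omega>. ennreal (Z \<omega> powr a * exp (- (b * Z \<omega>))) \<partial>M) =
      (\<integral>\<^sup>+x. ennreal (gamma_density v s x) * ennreal (x powr a * exp (- (b * x))) \<partial>lborel)"
    using Z by (intro distributed_nn_integral[symmetric]) (auto simp: gamma_distributed_def)
  also have "\<dots> = (\<integral>\<^sup>+x. ennreal (1 / (Gamma v * s powr v)) *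
      ennreal (indicator {0<..} x * (x powr (v + a - 1) * exp (- ((b + 1 / s) * x)))) \<partial>lborel)"
  proof (intro nn_integral_cong)
    fix x :: real
    show "ennreal (gamma_density v s x) * ennreal (x powr a * exp (- (b * x))) =
        ennreal (1 / (Gamma v * s powr v)) *
        ennreal (indicator {0<..} x * (x powr (v + a - 1) * exp (- ((b + 1 / s) * x))))"
    proof (cases "0 < x")
      case True
      have "x powr (v - 1) * exp (- x / s) * (x powr a * exp (- (b * x))) =
          x powr (v + a - 1) * exp (- ((b + 1 / s) * x))"
        using True by (simp add: powr_add powr_diff exp_add[symmetric] field_simps)
      with True assms show ?thesis
        by (simp add: gamma_density_def ennreal_mult[symmetric])
    qed (simp add: gamma_density_def)
  qed
  also have "\<dots> = ennreal (1 / (Gamma v * s powr v)) *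
      ennreal (Gamma (v + a) * (b + 1 / s) powr (- (v + a)))"
    using assms by (subst nn_integral_cmult) (auto simp: nn_integral_powr_exp)
  also have "\<dots> = ennreal (Gamma (v + a) / (Gamma v * s powr v) * (b + 1 / s) powr (- a - v))"
    using assms by (simp add: ennreal_mult[symmetric] add.commute)
  finally show ?thesis .
qed

lemma nn_integral_exp_initial:
  assumes "0 \<le> (a::real)"
  shows "(\<integral>\<^sup>+z. ennreal (exp (- z)) * indicator {0<..<a} z \<partial>lborel) = ennreal (1 - exp (- a))"
proof -
  have "(\<integral>\<^sup>+z. ennreal (exp (- z)) * indicator {0<..<a} z \<partial>lborel) =
      (\<integral>\<^sup>+z. ennreal (exp (- z)) * indicator {0..a} z \<partial>lborel)"
    by (intro nn_integral_cong_AE eventually_mono[OF AE_conjI[OF AE_lborel_singleton[of 0] AE_lborel_singleton[of a]]])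
      (auto simp: indicator_def)
  also have "\<dots> = ennreal (- exp (- a) - (- exp (- 0)))"
    using assms
    by (intro nn_integral_FTC_Icc) (auto intro!: derivative_eq_intros simp flip: has_real_derivative_iff_has_vector_derivative)
  finally show ?thesis by simp
qed

lemma nn_integral_planar_path_loss:
  fixes \<alpha> t :: real
  assumes "2 < \<alpha>" "0 < t"
  shows "(\<integral>\<^sup>+x. ennreal (1 - exp (- (t * norm (x::real^2) powr (- \<alpha>)))) \<partial>lborel) =
    ennreal (pi * Gamma (1 - 2 / \<alpha>) * t powr (2 / \<alpha>))"
  \<comment> \<open>Layer cake: \<open>1 - exp (- b)\<close> is the integral of \<open>exp (- z)\<close> over \<open>0 < z < b\<close>, and the
    level sets of the path loss are punctured discs.\<close>
proof -
  define d where "d = 2 / \<alpha>"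
  have d: "0 < d" "d < 1" using assms by (auto simp: d_def)
  define D where "D = (\<lambda>z. {x::real^2. z < t * norm x powr (- \<alpha>)})"
  have D: "emeasure lborel (D z) = ennreal (pi * (t / z) powr d)" if "0 < z" for z
  proof -
    \<comment> \<open>The centre is missing because \<open>0 powr (- \<alpha>)\<close> is 0, so the
      path loss at the origin does not exceed the positive level \<open>z\<close>.\<close>
    have "D z = ball 0 ((t / z) powr (1 / \<alpha>)) - {0}"
    proof (intro set_eqI)
      fix x :: "real^2"
      show "x \<in> D z \<longleftrightarrow> x \<in> ball 0 ((t / z) powr (1 / \<alpha>)) - {0}"
      proof (cases "x = 0")
        case False
        have "z < t * norm x powr (- \<alpha>) \<longleftrightarrow> norm x powr \<alpha> < t / z"
          using False that assms by (simp add: powr_minus field_simps)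
        also have "\<dots> \<longleftrightarrow> (norm x powr \<alpha>) powr (1 / \<alpha>) < (t / z) powr (1 / \<alpha>)"
          using False that assms powr_less_mono2[of "1 / \<alpha>" "norm x powr \<alpha>" "t / z"]
            powr_less_cancel2[of "1 / \<alpha>" "norm x powr \<alpha>" "t / z"] by auto
        also have "(norm x powr \<alpha>) powr (1 / \<alpha>) = norm x"
          using assms by (simp add: powr_powr)
        finally show ?thesis
          using False by (simp add: D_def)
      qed (use that in \<open>simp add: D_def\<close>)
    qed
    then have "emeasure lborel (D z) = emeasure lborel (ball (0::real^2) ((t / z) powr (1 / \<alpha>)))"
      by (simp only:) (rule emeasure_Diff_null_set, auto simp: null_sets_def)
    also have "\<dots> = ennreal (pi * ((t / z) powr (1 / \<alpha>))\<^sup>2)"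
      by (simp add: emeasure_ball unit_ball_vol_2)
    also have "((t / z) powr (1 / \<alpha>))\<^sup>2 = (t / z) powr d"
      using that assms by (simp add: powr_powr power2_eq_square powr_add[symmetric] d_def)
    finally show ?thesis .
  qed
  have [measurable]: "(\<lambda>x::real^2. norm x powr (- \<alpha>)) \<in> borel_measurable borel"
    by measurable
  have "(\<integral>\<^sup>+x. ennreal (1 - exp (- (t * norm (x::real^2) powr (- \<alpha>)))) \<partial>lborel) =
      (\<integral>\<^sup>+x. \<integral>\<^sup>+z. ennreal (exp (- z)) * indicator {0<..<t * norm (x::real^2) powr (- \<alpha>)} z \<partial>lborel \<partial>lborel)"
    using assms by (intro nn_integral_cong) (simp add: nn_integral_exp_initial)
  also have "\<dots> = (\<integral>\<^sup>+x. \<integral>\<^sup>+z. (if 0 < z \<and> z < t * norm (x::real^2) powr (- \<alpha>) then ennreal (exp (- z)) else 0) \<partial>lborel \<partial>lborel)"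
    by (intro nn_integral_cong) (auto simp: indicator_def)
  also have "\<dots> = (\<integral>\<^sup>+z. \<integral>\<^sup>+x. (if 0 < z \<and> z < t * norm (x::real^2) powr (- \<alpha>) then ennreal (exp (- z)) else 0) \<partial>lborel \<partial>lborel)"
    by (intro lborel_pair.Fubini'[symmetric]) measurable
  \<comment> \<open>The area of a level set contributes \<open>z powr (- d)\<close>, and together
    with the weight \<open>exp (- z)\<close> this is Euler's integral for
    \<open>Gamma (1 - d)\<close>, convergent since \<open>d < 1\<close>.\<close>
  also have "\<dots> = (\<integral>\<^sup>+z. ennreal (pi * t powr d) *
      ennreal (indicator {0<..} z * (z powr ((1 - d) - 1) * exp (- (1 * z)))) \<partial>lborel)"
  proof (intro nn_integral_cong)
    fix z :: real
    show "(\<integral>\<^sup>+x. (if 0 < z \<and> z < t * norm (x::real^2) powr (- \<alpha>) then ennreal (exp (- z)) else 0) \<partial>lborel) =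
        ennreal (pi * t powr d) * ennreal (indicator {0<..} z * (z powr ((1 - d) - 1) * exp (- (1 * z))))"
    proof (cases "0 < z")
      case True
      have D_sets [measurable]: "D z \<in> sets borel"
        unfolding D_def by measurable
      have "(\<integral>\<^sup>+x. (if 0 < z \<and> z < t * norm (x::real^2) powr (- \<alpha>) then ennreal (exp (- z)) else 0) \<partial>lborel) =
          (\<integral>\<^sup>+x. ennreal (exp (- z)) * indicator (D z) x \<partial>lborel)"
        using True by (intro nn_integral_cong) (auto simp: D_def)
      also have "\<dots> = ennreal (exp (- z)) * ennreal (pi * (t / z) powr d)"
        using True by (subst nn_integral_cmult_indicator) (simp_all add: D D_sets)
      finally show ?thesis
        using True assms by (simp add: ennreal_mult[symmetric] powr_divide powr_minus field_simps)
    qed simp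
  qed
  also have "\<dots> = ennreal (pi * t powr d) * ennreal (Gamma (1 - d) * 1 powr (- (1 - d)))"
    using d by (subst nn_integral_cmult) (simp_all only: nn_integral_powr_exp, auto)
  also have "\<dots> = ennreal (pi * Gamma (1 - d) * t powr d)"
    using d by (simp add: ennreal_mult[symmetric] mult_ac)
  finally show ?thesis by (simp add: d_def)
qed

section \<open>Independent sources\<close>

text \<open>The pair \<open>(\<omega>, V \<omega>)\<close>, with its first component observed only
  through \<open>F\<close>, has the product of the restricted measure and the law of
  \<open>V\<close> as its distribution; this is checked on rectangles, and Fubini does the rest.
  Keeping \<open>\<omega>\<close> itself as first component allows \<open>f\<close> to depend on any
  number of sources of different types.\<close>

lemma (in prob_space) nn_integral_indep_subalgebra:
  assumes F: "subalgebra M F" and V [measurable]: "V \<in> measurable M N"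
    and indep: "\<And>A B. A \<in> sets F \<Longrightarrow> B \<in> sets N \<Longrightarrow>
      prob (A \<inter> (V -` B \<inter> space M)) = prob A * prob (V -` B \<inter> space M)"
    and f: "case_prod f \<in> borel_measurable (F \<Otimes>\<^sub>M N)"
  shows "(\<integral>\<^sup>+\<omega>. f \<omega> (V \<omega>) \<partial>M) = (\<integral>\<^sup>+\<omega>. (\<integral>\<^sup>+\<omega>'. f \<omega> (V \<omega>') \<partial>M) \<partial>M)"
proof -
  define R where "R = restr_to_subalg M F"
  define D where "D = distr M N V"
  interpret R: prob_space R
    unfolding R_def by (rule prob_space_restr_to_subalg[OF F]) (rule prob_space_axioms)
  interpret D: prob_space D
    unfolding D_def by (rule prob_space_distr) fact
  have sets_R [measurable_cong]: "sets R = sets F"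
    unfolding R_def by (rule sets_restr_to_subalg[OF F])
  have sets_D [measurable_cong]: "sets D = sets N"
    by (simp add: D_def)
  have spF: "space F = space M" and F_M: "sets F \<subseteq> sets M"
    using F by (auto simp: subalgebra_def)
  have pair [measurable]: "(\<lambda>\<omega>. (\<omega>, V \<omega>)) \<in> measurable M (F \<Otimes>\<^sub>M N)"
  proof (rule measurable_Pair)
    show "(\<lambda>\<omega>. \<omega>) \<in> measurable M F"
      using spF F_M by (auto simp: measurable_def sets.sets_into_space Int_absorb2)
  qed fact
  have RD: "R \<Otimes>\<^sub>M D = distr M (F \<Otimes>\<^sub>M N) (\<lambda>\<omega>. (\<omega>, V \<omega>))"
  proof (rule pair_measure_eqI)
    show "sets (R \<Otimes>\<^sub>M D) = sets (distr M (F \<Otimes>\<^sub>M N) (\<lambda>\<omega>. (\<omega>, V \<omega>)))"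
      using sets_pair_measure_cong[OF sets_R sets_D] by simp
    fix A B assume "A \<in> sets R" "B \<in> sets D"
    then have A: "A \<in> sets F" and B: "B \<in> sets N"
      by (simp_all add: sets_R sets_D)
    have "emeasure (distr M (F \<Otimes>\<^sub>M N) (\<lambda>\<omega>. (\<omega>, V \<omega>))) (A \<times> B) =
        emeasure M (A \<inter> (V -` B \<inter> space M))"
      using A B F_M by (subst emeasure_distr) (auto intro!: arg_cong[of _ _ "emeasure M"] dest: sets.sets_into_space)
    also have "\<dots> = emeasure M A * emeasure M (V -` B \<inter> space M)"
      using indep[OF A B] by (simp add: emeasure_eq_measure ennreal_mult)
    also have "\<dots> = emeasure R A * emeasure D B"
      using A B by (simp add: R_def D_def emeasure_restr_to_subalg[OF F] emeasure_distr)
    finally show "emeasure R A * emeasure D B = emeasure (distr M (F \<Otimes>\<^sub>M N) (\<lambda>\<omega>. (\<omega>, V \<omega>))) (A \<times> B)" ..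
  qed unfold_locales
  have f' [measurable]: "case_prod f \<in> borel_measurable (R \<Otimes>\<^sub>M D)"
    using f by measurable
  have f'' [measurable]: "case_prod f \<in> borel_measurable (F \<Otimes>\<^sub>M D)"
    using f by measurable
  have "(\<integral>\<^sup>+\<omega>. f \<omega> (V \<omega>) \<partial>M) = (\<integral>\<^sup>+p. case_prod f p \<partial>distr M (F \<Otimes>\<^sub>M N) (\<lambda>\<omega>. (\<omega>, V \<omega>)))"
    using f by (subst nn_integral_distr) auto
  also have "\<dots> = (\<integral>\<^sup>+\<omega>. \<integral>\<^sup>+v. f \<omega> v \<partial>D \<partial>R)"
    unfolding RD[symmetric] by (subst D.nn_integral_fst[symmetric]) auto
  also have "\<dots> = (\<integral>\<^sup>+\<omega>. \<integral>\<^sup>+v. f \<omega> v \<partial>D \<partial>M)"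
    unfolding R_def using D.borel_measurable_nn_integral_fst[OF f'']
    by (intro nn_integral_subalgebra2[OF F]) simp
  also have "\<dots> = (\<integral>\<^sup>+\<omega>. (\<integral>\<^sup>+\<omega>'. f \<omega> (V \<omega>') \<partial>M) \<partial>M)"
  proof (intro nn_integral_cong)
    fix \<omega> assume "\<omega> \<in> space M"
    then have "(\<lambda>v. f \<omega> v) \<in> borel_measurable N"
      using f spF by (intro measurable_Pair2[of "case_prod f", simplified]) auto
    then show "(\<integral>\<^sup>+v. f \<omega> v \<partial>D) = (\<integral>\<^sup>+\<omega>'. f \<omega> (V \<omega>') \<partial>M)"
      unfolding D_def by (intro nn_integral_distr[OF V]) (simp only: measurable_distr_eq1)
  qed
  finally show ?thesis .
qed

text \<open>Given as a measure space so that measurability with respect to it expresses dependence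
  on the sources other than \<open>i\<close> only.\<close>

definition other_sources ::
  "'w measure \<Rightarrow> ('w \<Rightarrow> real) \<Rightarrow> ('w \<Rightarrow> real) \<Rightarrow> (nat \<Rightarrow> 'w \<Rightarrow> real^2) \<Rightarrow> (nat \<Rightarrow> 'w \<Rightarrow> real) \<Rightarrow>
   source \<Rightarrow> 'w measure" where
  "other_sources M W Y X \<Psi> i = sigma (space M) (\<Union>j\<in>-{i}. source_events M W Y X \<Psi> j)"

locale independent_sources = prob_space M
  for M :: "'w measure" and W Y :: "'w \<Rightarrow> real" and X :: "nat \<Rightarrow> 'w \<Rightarrow> real^2"
    and \<Psi> :: "nat \<Rightarrow> 'w \<Rightarrow> real" +
  assumes mutually_independent: "mutually_independent M W Y X \<Psi>"
begin

abbreviation "events_of \<equiv> source_events M W Y X \<Psi>"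
abbreviation "others \<equiv> other_sources M W Y X \<Psi>"

lemma indep_events_of: "indep_sets events_of UNIV"
  using mutually_independent by (simp add: mutually_independent_def)

lemma events_of_subset: "events_of i \<subseteq> events"
  using indep_events_of by (auto simp: indep_sets_def)

lemma space_others [simp]: "space (others i) = space M"
  by (simp add: other_sources_def space_measure_of_conv)

lemma sets_others: "sets (others i) = sigma_sets (space M) (\<Union>j\<in>-{i}. events_of j)"
  unfolding other_sources_def
  by (intro sets_measure_of UN_least order_trans[OF events_of_subset sets.space_closed])

lemma subalgebra_others: "subalgebra M (others i)"
  unfolding subalgebra_def
  by (intro conjI space_others) (simp only: sets_others sets.sigma_sets_subset UN_least events_of_subset)

lemma measurable_source:
  assumes "events_of j = sets (vimage_algebra (space M) V N)" "V \<in> space M \<rightarrow> space N"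
    "space F = space M" "events_of j \<subseteq> sets F"
  shows "V \<in> measurable F N"
proof (rule measurableI)
  fix A assume "A \<in> sets N"
  then have "V -` A \<inter> space M \<in> events_of j"
    using assms(1,2) by (simp add: in_vimage_algebra)
  then show "V -` A \<inter> space F \<in> sets F"
    using assms(3,4) by auto
qed (use assms(2,3) in auto)

lemma events_of_others: "j \<noteq> i \<Longrightarrow> events_of j \<subseteq> sets (others i)"
  unfolding sets_others by auto

lemma measurable_others:
  "i \<noteq> Signal \<Longrightarrow> W \<in> borel_measurable (others i)"
  "i \<noteq> Self_Interference \<Longrightarrow> Y \<in> borel_measurable (others i)"
  "i \<noteq> Mark l \<Longrightarrow> \<Psi> l \<in> borel_measurable (others i)"
  by (intro measurable_source[where j=Signal] measurable_source[where j=Self_Interference]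
      measurable_source[where j="Mark l"] events_of_others; simp)+

lemma sources_measurable [measurable]:
  "W \<in> borel_measurable M" "Y \<in> borel_measurable M" "\<Psi> l \<in> borel_measurable M"
  by (intro measurable_source[where j=Signal] measurable_source[where j=Self_Interference]
      measurable_source[where j="Mark l"] events_of_subset; simp)+

text \<open>One source is averaged while all the others are held fixed. The independence required
  for this comes from splitting the index set into \<open>{i}\<close> and its complement and passing
  to the generated sigma-algebras, which is legitimate because the events of each source are closed
  under intersection.\<close>

lemma nn_integral_indep_source:
  assumes V: "events_of i = sets (vimage_algebra (space M) V borel)"
    and f: "case_prod f \<in> borel_measurable (others i \<Otimes>\<^sub>M (borel :: real measure))"
  shows "(\<integral>\<^sup>+\<omega>. f \<omega> (V \<omega>) \<partial>M) = (\<integral>\<^sup>+\<omega>. (\<integral>\<^sup>+\<omega>'. f \<omega> (V \<omega>') \<partial>M) \<partial>M)"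
proof (rule nn_integral_indep_subalgebra[OF subalgebra_others _ _ f])
  show "V \<in> borel_measurable M"
    using events_of_subset by (intro measurable_source[OF V]) auto
  fix A and B :: "real set" assume A: "A \<in> sets (others i)" and B: "B \<in> sets borel"
  have "indep_sets (\<lambda>b. sigma_sets (space M) (\<Union>j\<in>(case b of True \<Rightarrow> -{i} | False \<Rightarrow> {i}). events_of j)) UNIV"
  proof (rule indep_sets_collect_sigma)
    have "(\<Union>b. case b of True \<Rightarrow> -{i} | False \<Rightarrow> {i}) = UNIV"
      by (auto simp: UNIV_bool)
    then show "indep_sets events_of (\<Union>b. case b of True \<Rightarrow> -{i} | False \<Rightarrow> {i})"
      using indep_events_of by simp
    show "Int_stable (events_of j)" for j
      by (cases j) (simp_all only: source_events.simps sets.Int_stable)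
    show "disjoint_family (case_bool (- {i}) {i})"
      by (simp add: disjoint_family_on_def split: bool.split)
  qed
  then have "indep_sets (case_bool (sets (others i)) (sigma_sets (space M) (events_of i))) UNIV"
    by (rule indep_sets_mono_sets) (simp add: sets_others split: bool.split)
  then have "indep_set (sets (others i)) (sigma_sets (space M) (events_of i))"
    by (simp add: indep_set_def)
  moreover have "V -` B \<inter> space M \<in> sigma_sets (space M) (events_of i)"
    unfolding V by (intro sigma_sets.Basic in_vimage_algebra B)
  ultimately show "prob (A \<inter> (V -` B \<inter> space M)) = prob A * prob (V -` B \<inter> space M)"
    using A by (intro indep_setD)
qed

lemma points_measurable:
  "i \<noteq> Points \<Longrightarrow> X l \<in> borel_measurable (others i)" "X l \<in> borel_measurable M"
proof -
  have *: "X l \<in> borel_measurable F" if "space F = space M" "events_of Points \<subseteq> sets F" for F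
  proof -
    have "(\<lambda>\<omega> l. X l \<omega>) \<in> measurable F (Pi\<^sub>M UNIV (\<lambda>_. borel))"
      using that by (intro measurable_source[where j=Points]) (auto simp: space_PiM)
    then show ?thesis
      using measurable_compose[OF _ measurable_component_singleton[of l UNIV "\<lambda>_. borel"]] by simp
  qed
  show "i \<noteq> Points \<Longrightarrow> X l \<in> borel_measurable (others i)" "X l \<in> borel_measurable M"
    using *[of "others i"] *[of M] events_of_others[of Points i]
      events_of_subset[of Points] by simp_all
qed

end

section \<open>Laplace transform of the interference\<close>

lemma nn_integral_gamma_laplace:
  assumes Z: "gamma_distributed M Z v s" and "0 < v" "0 < s" "0 \<le> b"
  shows "(\<integral>\<^sup>+\<omega>. ennreal (exp (- (b * Z \<omega>))) \<partial>M) = ennreal ((1 + b * s) powr (- v))"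
proof -
  \<comment> \<open>The value of \<open>0 powr 0\<close> is 0, so inserting the factor
    \<open>Z \<omega> powr 0\<close> is correct only almost surely, by positivity of
    \<open>Z\<close>.\<close>
  have "(\<integral>\<^sup>+\<omega>. ennreal (exp (- (b * Z \<omega>))) \<partial>M) =
      (\<integral>\<^sup>+\<omega>. ennreal (Z \<omega> powr 0 * exp (- (b * Z \<omega>))) \<partial>M)"
    using gamma_distributed_AE_pos[OF Z] by (intro nn_integral_cong_AE) (auto elim!: eventually_mono)
  also have "\<dots> = ennreal (Gamma (v + 0) / (Gamma v * s powr v) * (b + 1 / s) powr (- 0 - v))"
    using assms by (intro gamma_distributed_moment) (auto intro: add_nonneg_pos)
  also have "Gamma (v + 0) / (Gamma v * s powr v) * (b + 1 / s) powr (- 0 - v) =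
      s powr (- v) * (b + 1 / s) powr (- v)"
    using Gamma_real_pos[OF \<open>0 < v\<close>] by (simp add: powr_minus divide_inverse)
  also have "\<dots> = (s * (b + 1 / s)) powr (- v)"
    using assms by (intro powr_mult[symmetric])
  also have "s * (b + 1 / s) = 1 + b * s"
    using assms by (simp add: field_simps)
  finally show ?thesis .
qed

text \<open>The constant \<open>C\<close> of the overview:
  \<open>pi * Gamma (1 - 2 / \<alpha>)\<close> is the planar integral of
  \<open>1 - exp (- (norm x powr (- \<alpha>)))\<close>, and the last factor is the moment of order
  \<open>2 / \<alpha>\<close> of a mark.\<close>

definition interference_rate :: "real \<Rightarrow> real \<Rightarrow> real \<Rightarrow> real" where
  "interference_rate \<alpha> n \<Omega> = pi * Gamma (1 - 2 / \<alpha>) * (Gamma (n + 2 / \<alpha>) / Gamma n * \<Omega> powr (2 / \<alpha>))"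

locale interference = independent_sources M W Y X \<Psi>
  for M :: "'w measure" and W Y :: "'w \<Rightarrow> real" and X :: "nat \<Rightarrow> 'w \<Rightarrow> real^2"
    and \<Psi> :: "nat \<Rightarrow> 'w \<Rightarrow> real" +
  fixes \<mu> \<alpha> n \<Omega> :: real
  assumes ppp: "homogeneous_PPP M \<mu> X"
    and marks: "\<And>l. gamma_distributed M (\<Psi> l) n \<Omega>"
    and \<mu>_pos: "0 < \<mu>" and \<alpha>_gt_2: "2 < \<alpha>" and n_pos: "0 < n" and \<Omega>_pos: "0 < \<Omega>"
begin

abbreviation term_at :: "nat \<Rightarrow> 'w \<Rightarrow> real" where
  "term_at l \<omega> \<equiv> norm (X l \<omega>) powr (- \<alpha>) * \<Psi> l \<omega>"

definition total :: "'w \<Rightarrow> ennreal" where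
  "total \<omega> = (\<Sum>l. ennreal (term_at l \<omega>))"

abbreviation rate :: real where
  "rate \<equiv> interference_rate \<alpha> n \<Omega>"

lemma points_borel [measurable]: "X l \<in> borel_measurable M"
  by (rule points_measurable)

lemma measurable_total [measurable]: "total \<in> borel_measurable M"
  unfolding total_def by measurable

lemma AE_marks_pos: "AE \<omega> in M. \<forall>l. 0 < \<Psi> l \<omega>"
  using gamma_distributed_AE_pos[OF marks] by (simp add: AE_all_countable)

lemma mark_laplace:
  "0 \<le> b \<Longrightarrow> (\<integral>\<^sup>+\<omega>. ennreal (exp (- (b * \<Psi> l \<omega>))) \<partial>M) = ennreal ((1 + b * \<Omega>) powr (- n))"
  using nn_integral_gamma_laplace[OF marks n_pos \<Omega>_pos] .

text \<open>The weight \<open>R\<close> is what makes the induction go through: averaging the last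
  mark leaves a factor that depends on the points only, and this factor joins the weight for the
  remaining marks. Hence \<open>R\<close> must be measurable without reference to any single
  mark.\<close>

lemma nn_integral_marks:
  assumes "0 \<le> t" and R: "\<And>l. R \<in> borel_measurable (others (Mark l))"
  shows "(\<integral>\<^sup>+\<omega>. R \<omega> * (\<Prod>l<N. ennreal (exp (- (t * term_at l \<omega>)))) \<partial>M) =
    (\<integral>\<^sup>+\<omega>. R \<omega> * (\<Prod>l<N. ennreal ((1 + t * norm (X l \<omega>) powr (- \<alpha>) * \<Omega>) powr (- n))) \<partial>M)"
  using R
proof (induction N arbitrary: R)
  case (Suc N)
  note [measurable] = Suc.prems
  have X_others [measurable]: "X l \<in> borel_measurable (others (Mark k))" for l k
    by (rule points_measurable) simp
  have \<Psi>_others: "\<Psi> l \<in> borel_measurable (others (Mark N))" if "l < N" for l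
    using that by (intro measurable_others) simp
  define P where "P = (\<lambda>\<omega>. \<Prod>l<N. ennreal (exp (- (t * term_at l \<omega>))))"
  define v where "v = (\<lambda>l \<omega>. ennreal ((1 + t * norm (X l \<omega>) powr (- \<alpha>) * \<Omega>) powr (- n)))"
  have P_meas [measurable]: "P \<in> borel_measurable (others (Mark N))"
    unfolding P_def
  proof (intro borel_measurable_prod_ennreal)
    fix l assume "l \<in> {..<N}"
    then have [measurable]: "\<Psi> l \<in> borel_measurable (others (Mark N))"
      by (intro \<Psi>_others) simp
    show "(\<lambda>\<omega>. ennreal (exp (- (t * term_at l \<omega>)))) \<in> borel_measurable (others (Mark N))"
      by measurable
  qed
  have "(\<integral>\<^sup>+\<omega>. R \<omega> * (\<Prod>l<Suc N. ennreal (exp (- (t * term_at l \<omega>)))) \<partial>M) =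
      (\<integral>\<^sup>+\<omega>. R \<omega> * P \<omega> * ennreal (exp (- (t * norm (X N \<omega>) powr (- \<alpha>) * \<Psi> N \<omega>))) \<partial>M)"
    by (simp add: P_def mult_ac)
  also have "\<dots> = (\<integral>\<^sup>+\<omega>. (\<integral>\<^sup>+\<omega>'. R \<omega> * P \<omega> *
      ennreal (exp (- (t * norm (X N \<omega>) powr (- \<alpha>) * \<Psi> N \<omega>'))) \<partial>M) \<partial>M)"
    by (intro nn_integral_indep_source[of "Mark N" "\<Psi> N"
        "\<lambda>\<omega> z. R \<omega> * P \<omega> * ennreal (exp (- (t * norm (X N \<omega>) powr (- \<alpha>) * z)))"]) auto
  also have "\<dots> = (\<integral>\<^sup>+\<omega>. R \<omega> * v N \<omega> * P \<omega> \<partial>M)"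
    using \<open>0 \<le> t\<close> by (intro nn_integral_cong, subst nn_integral_cmult)
      (simp_all add: mark_laplace v_def, simp_all add: mult_ac)
  also have "\<dots> = (\<integral>\<^sup>+\<omega>. R \<omega> * v N \<omega> * (\<Prod>l<N. v l \<omega>) \<partial>M)"
    unfolding P_def v_def using Suc.prems by (intro Suc.IH) measurable
  also have "\<dots> = (\<integral>\<^sup>+\<omega>. R \<omega> * (\<Prod>l<Suc N. v l \<omega>) \<partial>M)"
    by (simp add: mult_ac)
  finally show ?case
    by (simp only: v_def)
qed simp

lemma nn_integral_mark_power:
  "(\<integral>\<^sup>+\<omega>. ennreal (\<Psi> l \<omega> powr (2 / \<alpha>)) \<partial>M) = ennreal (Gamma (n + 2 / \<alpha>) / Gamma n * \<Omega> powr (2 / \<alpha>))"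
proof -
  have "(\<integral>\<^sup>+\<omega>. ennreal (\<Psi> l \<omega> powr (2 / \<alpha>) * exp (- (0 * \<Psi> l \<omega>))) \<partial>M) =
      ennreal (Gamma (n + 2 / \<alpha>) / (Gamma n * \<Omega> powr n) * (0 + 1 / \<Omega>) powr (- (2 / \<alpha>) - n))"
    using marks n_pos \<Omega>_pos \<alpha>_gt_2 by (intro gamma_distributed_moment) (auto intro: add_pos_pos)
  also have "(0 + 1 / \<Omega>) powr (- (2 / \<alpha>) - n) = \<Omega> powr (2 / \<alpha>) * \<Omega> powr n"
    using \<Omega>_pos by (simp add: powr_divide powr_add[symmetric] powr_minus_divide[symmetric] add.commute)
  finally show ?thesis
    using \<Omega>_pos by simp
qed

text \<open>The integrand is the mean over a mark of \<open>1 - exp (- (t * norm x powr (- \<alpha>)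
  * \<Psi> 0 \<omega>))\<close>. Integrating over the plane before averaging turns the mark into a
  rescaling of \<open>t\<close>, which contributes its power \<open>2 / \<alpha>\<close>.\<close>

lemma nn_integral_one_point:
  assumes "0 < t"
  shows "(\<integral>\<^sup>+x. ennreal (1 - (1 + t * norm (x::real^2) powr (- \<alpha>) * \<Omega>) powr (- n)) \<partial>lborel) =
    ennreal (rate * t powr (2 / \<alpha>))"
proof -
  interpret pair_sigma_finite M "lborel :: (real^2) measure"
    by unfold_locales
  \<comment> \<open>The truncation \<open>max 0\<close> keeps the exponential at most 1 everywhere,
    as subtraction in \<open>ennreal\<close> requires; it changes nothing almost surely.\<close>
  let ?g = "\<lambda>x \<omega>. ennreal (1 - exp (- (t * norm (x::real^2) powr (- \<alpha>) * max 0 (\<Psi> 0 \<omega>))))"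
  have pos: "AE \<omega> in M. 0 < \<Psi> 0 \<omega>"
    using AE_marks_pos by eventually_elim simp
  have "(\<integral>\<^sup>+x. ennreal (1 - (1 + t * norm (x::real^2) powr (- \<alpha>) * \<Omega>) powr (- n)) \<partial>lborel) =
      (\<integral>\<^sup>+x. \<integral>\<^sup>+\<omega>. ?g x \<omega> \<partial>M \<partial>lborel)"
  proof (intro nn_integral_cong)
    fix x :: "real^2"
    define b where "b = t * norm x powr (- \<alpha>)"
    have "0 \<le> b"
      using assms by (simp add: b_def)
    have "(\<integral>\<^sup>+\<omega>. ?g x \<omega> \<partial>M) = (\<integral>\<^sup>+\<omega>. 1 - ennreal (exp (- (b * max 0 (\<Psi> 0 \<omega>)))) \<partial>M)"
      using \<open>0 \<le> b\<close> by (intro nn_integral_cong) (simp add: b_def ennreal_minus[symmetric])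
    also have "\<dots> = 1 - (\<integral>\<^sup>+\<omega>. ennreal (exp (- (b * max 0 (\<Psi> 0 \<omega>)))) \<partial>M)"
    proof (subst nn_integral_diff)
      have "(\<integral>\<^sup>+\<omega>. ennreal (exp (- (b * max 0 (\<Psi> 0 \<omega>)))) \<partial>M) \<le> (\<integral>\<^sup>+\<omega>. 1 \<partial>M)"
        using \<open>0 \<le> b\<close> by (intro nn_integral_mono) simp
      then show "(\<integral>\<^sup>+\<omega>. ennreal (exp (- (b * max 0 (\<Psi> 0 \<omega>)))) \<partial>M) \<noteq> \<infinity>"
        by (auto simp: emeasure_space_1 top_unique)
    qed (use \<open>0 \<le> b\<close> in \<open>auto simp: emeasure_space_1\<close>)
    also have "(\<integral>\<^sup>+\<omega>. ennreal (exp (- (b * max 0 (\<Psi> 0 \<omega>)))) \<partial>M) =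
        (\<integral>\<^sup>+\<omega>. ennreal (exp (- (b * \<Psi> 0 \<omega>))) \<partial>M)"
      by (intro nn_integral_cong_AE, use pos in eventually_elim) (simp add: max_def)
    also have "\<dots> = ennreal ((1 + b * \<Omega>) powr (- n))"
      using \<open>0 \<le> b\<close> by (rule mark_laplace)
    also have "1 - ennreal ((1 + b * \<Omega>) powr (- n)) = ennreal (1 - (1 + b * \<Omega>) powr (- n))"
      by (simp add: ennreal_minus[symmetric])
    finally show "ennreal (1 - (1 + t * norm x powr (- \<alpha>) * \<Omega>) powr (- n)) = (\<integral>\<^sup>+\<omega>. ?g x \<omega> \<partial>M)"
      by (simp only: b_def)
  qed
  also have "\<dots> = (\<integral>\<^sup>+\<omega>. \<integral>\<^sup>+x. ?g x \<omega> \<partial>lborel \<partial>M)"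
    by (rule Fubini') measurable
  also have "\<dots> = (\<integral>\<^sup>+\<omega>. ennreal (pi * Gamma (1 - 2 / \<alpha>) * t powr (2 / \<alpha>)) * ennreal (\<Psi> 0 \<omega> powr (2 / \<alpha>)) \<partial>M)"
  proof (intro nn_integral_cong_AE, use pos in eventually_elim)
    case (elim \<omega>)
    have "(\<integral>\<^sup>+x. ?g x \<omega> \<partial>lborel) =
        (\<integral>\<^sup>+x. ennreal (1 - exp (- ((t * \<Psi> 0 \<omega>) * norm (x::real^2) powr (- \<alpha>)))) \<partial>lborel)"
      using elim by (intro nn_integral_cong) (simp add: max_def mult_ac)
    also have "\<dots> = ennreal (pi * Gamma (1 - 2 / \<alpha>) * (t * \<Psi> 0 \<omega>) powr (2 / \<alpha>))"
      using elim assms \<alpha>_gt_2 by (intro nn_integral_planar_path_loss) auto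
    also have "(t * \<Psi> 0 \<omega>) powr (2 / \<alpha>) = t powr (2 / \<alpha>) * \<Psi> 0 \<omega> powr (2 / \<alpha>)"
      using elim assms by (simp add: powr_mult)
    finally show ?case
      by (simp add: ennreal_mult''[symmetric] mult.assoc)
  qed
  also have "\<dots> = ennreal (pi * Gamma (1 - 2 / \<alpha>) * t powr (2 / \<alpha>)) *
      ennreal (Gamma (n + 2 / \<alpha>) / Gamma n * \<Omega> powr (2 / \<alpha>))"
    by (subst nn_integral_cmult) (auto simp: nn_integral_mark_power)
  also have "\<dots> = ennreal (rate * t powr (2 / \<alpha>))"
  proof (subst ennreal_mult''[symmetric])
    have "0 < n + 2 / \<alpha>"
      using n_pos \<alpha>_gt_2 by (intro add_pos_pos) auto
    then show "0 \<le> Gamma (n + 2 / \<alpha>) / Gamma n * \<Omega> powr (2 / \<alpha>)"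
      using n_pos by (intro mult_nonneg_nonneg divide_nonneg_nonneg less_imp_le[OF Gamma_real_pos]) auto
  qed (simp add: interference_rate_def mult_ac)
  finally show ?thesis .
qed

lemma rate_pos: "0 < rate"
  unfolding interference_rate_def using n_pos \<Omega>_pos \<alpha>_gt_2
  by (intro mult_pos_pos divide_pos_pos Gamma_real_pos) (auto intro: add_pos_pos)

lemma laplace_total_ennreal:
  assumes "0 < t"
  shows "(\<integral>\<^sup>+\<omega>. ennreal (exp_neg (ennreal t * total \<omega>)) \<partial>M) =
    ennreal (exp (- (\<mu> * (rate * t powr (2 / \<alpha>)))))"
proof -
  define v where "v = (\<lambda>x::real^2. (1 + t * norm x powr (- \<alpha>) * \<Omega>) powr (- n))"
  have base: "1 \<le> 1 + t * norm x powr (- \<alpha>) * \<Omega>" for x :: "real^2"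
    using assms \<Omega>_pos by simp
  have v: "0 < v x" "v x \<le> 1" for x
  proof -
    show "0 < v x"
      using base[of x] by (simp add: v_def)
    show "v x \<le> 1"
      using base[of x] n_pos powr_mono[of "- n" 0 "1 + t * norm x powr (- \<alpha>) * \<Omega>"]
      by (simp add: v_def)
  qed
  \<comment> \<open>The logarithm makes \<open>exp_neg (f x)\<close> equal to the averaged factor of
    a point at \<open>x\<close>; \<open>f\<close> is a proper nonnegative function because
    \<open>v x \<le> 1\<close>.\<close>
  define f where "f = (\<lambda>x. ennreal (- ln (v x)))"
  have exp_f: "exp_neg (f x) = v x" for x
    using v[of x] by (simp add: f_def)
  have [measurable]: "v \<in> borel_measurable borel" "f \<in> borel_measurable borel"
    unfolding f_def v_def by measurable
  have lim: "(\<lambda>N. \<Prod>l<N. exp_neg (g l)) \<longlonglongrightarrow> exp_neg (\<Sum>l. g l)" for g :: "nat \<Rightarrow> ennreal"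
  proof -
    have "(\<lambda>N. exp_neg (\<Sum>l<N. g l)) \<longlonglongrightarrow> exp_neg (\<Sum>l. g l)"
      by (intro tendsto_exp_neg summable_LIMSEQ) simp
    then show ?thesis
      by (simp add: exp_neg_sum)
  qed
  have bound: "(\<Prod>l<N. ennreal (exp_neg (g l))) \<le> 1" for g :: "nat \<Rightarrow> ennreal" and N
    by (intro prod_le_1) simp
  \<comment> \<open>Only finitely many marks can be averaged by induction, so both infinite products
    are reached as limits of finite ones, dominated by 1.\<close>
  have "(\<lambda>N. \<integral>\<^sup>+\<omega>. (\<Prod>l<N. ennreal (exp_neg (ennreal (t * term_at l \<omega>)))) \<partial>M) \<longlonglongrightarrow>
      (\<integral>\<^sup>+\<omega>. ennreal (exp_neg (\<Sum>l. ennreal (t * term_at l \<omega>))) \<partial>M)"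
    by (rule nn_integral_dominated_convergence[where w="\<lambda>_. 1"])
      (use bound in \<open>auto simp: prod_ennreal emeasure_space_1 intro!: AE_I2 tendsto_ennrealI lim\<close>)
  moreover have "(\<lambda>N. \<integral>\<^sup>+\<omega>. (\<Prod>l<N. ennreal (exp_neg (f (X l \<omega>)))) \<partial>M) \<longlonglongrightarrow>
      (\<integral>\<^sup>+\<omega>. ennreal (exp_neg (\<Sum>l. f (X l \<omega>))) \<partial>M)"
    by (rule nn_integral_dominated_convergence[where w="\<lambda>_. 1"])
      (use bound in \<open>auto simp: prod_ennreal emeasure_space_1 intro!: AE_I2 tendsto_ennrealI lim\<close>)
  moreover have "(\<integral>\<^sup>+\<omega>. (\<Prod>l<N. ennreal (exp_neg (ennreal (t * term_at l \<omega>)))) \<partial>M) =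
      (\<integral>\<^sup>+\<omega>. (\<Prod>l<N. ennreal (exp_neg (f (X l \<omega>)))) \<partial>M)" for N
  proof -
    have "(\<integral>\<^sup>+\<omega>. (\<Prod>l<N. ennreal (exp_neg (ennreal (t * term_at l \<omega>)))) \<partial>M) =
        (\<integral>\<^sup>+\<omega>. 1 * (\<Prod>l<N. ennreal (exp (- (t * term_at l \<omega>)))) \<partial>M)"
    proof (intro nn_integral_cong_AE, use AE_marks_pos in eventually_elim)
      case (elim \<omega>)
      then have "0 \<le> t * term_at l \<omega>" for l
        using assms by (simp add: less_imp_le)
      then show ?case
        by simp
    qed
    also have "\<dots> = (\<integral>\<^sup>+\<omega>. 1 * (\<Prod>l<N. ennreal (v (X l \<omega>))) \<partial>M)"
      unfolding v_def using assms by (intro nn_integral_marks) auto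
    finally show ?thesis
      by (simp add: exp_f)
  qed
  ultimately have "(\<integral>\<^sup>+\<omega>. ennreal (exp_neg (\<Sum>l. ennreal (t * term_at l \<omega>))) \<partial>M) =
      (\<integral>\<^sup>+\<omega>. ennreal (exp_neg (\<Sum>l. f (X l \<omega>))) \<partial>M)"
    using LIMSEQ_unique by simp
  also have "\<dots> = ennreal (exp_neg (ennreal \<mu> * (\<integral>\<^sup>+x. ennreal (1 - exp_neg (f x)) \<partial>lborel)))"
    using ppp \<mu>_pos by (intro PPP_laplace_functional) auto
  also have "(\<integral>\<^sup>+x. ennreal (1 - exp_neg (f x)) \<partial>lborel) = ennreal (rate * t powr (2 / \<alpha>))"
    unfolding exp_f v_def by (rule nn_integral_one_point[OF assms])
  also have "ennreal \<mu> * \<dots> = ennreal (\<mu> * (rate * t powr (2 / \<alpha>)))"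
    using \<mu>_pos rate_pos by (intro ennreal_mult[symmetric]) auto
  also have "exp_neg \<dots> = exp (- (\<mu> * (rate * t powr (2 / \<alpha>))))"
    using \<mu>_pos rate_pos by (intro exp_neg_ennreal) auto
  also have "(\<integral>\<^sup>+\<omega>. ennreal (exp_neg (\<Sum>l. ennreal (t * term_at l \<omega>))) \<partial>M) =
      (\<integral>\<^sup>+\<omega>. ennreal (exp_neg (ennreal t * total \<omega>)) \<partial>M)"
    using assms by (simp add: total_def ennreal_mult')
  finally show ?thesis .
qed

end

section \<open>Moments of the interference\<close>

text \<open>A single term of the exponential series is at most the whole series.\<close>

lemma power_mult_exp_bound:
  fixes x t :: real
  assumes "0 \<le> x" "0 < t"
  shows "x ^ k * exp (- (t * x)) \<le> fact k / t ^ k"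
proof -
  have "(\<Sum>i\<in>{k}. (t * x) ^ i /\<^sub>R fact i) \<le> (\<Sum>i. (t * x) ^ i /\<^sub>R fact i)"
    using assms summable_exp_generic[of "t * x"] by (intro sum_le_suminf) auto
  then have "(t * x) ^ k / fact k \<le> exp (t * x)"
    by (simp add: exp_def divide_inverse mult.commute)
  then have "(t * x) ^ k \<le> fact k * exp (t * x)"
    by (simp add: field_simps)
  then have "(t * x) ^ k * exp (- (t * x)) \<le> fact k"
    by (simp add: exp_minus field_simps)
  then show ?thesis
    using assms by (simp add: power_mult_distrib field_simps)
qed

text \<open>Half of the decay rate is sacrificed: the growth \<open>exp \<bar>h * x\<bar>\<close> of
  the remainder is absorbed by \<open>exp (- (t * x))\<close>, leaving
  \<open>exp (- (t / 2 * x))\<close> uniformly in \<open>h\<close>.\<close>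

lemma exp_linear_remainder:
  fixes x t h :: real
  assumes "0 \<le> x" "\<bar>h\<bar> \<le> t / 2"
  shows "\<bar>exp (- ((t + h) * x)) - exp (- (t * x)) + h * (x * exp (- (t * x)))\<bar> \<le>
    h\<^sup>2 * (x\<^sup>2 * exp (- (t / 2 * x)))"
proof -
  have "\<bar>exp (- (h * x)) - (1 + - (h * x))\<bar> \<le> exp \<bar>h * x\<bar> * (h * x)\<^sup>2"
    using Taylor_exp_field[of "- (h * x)" 1] by (simp add: power2_eq_square)
  also have "\<dots> \<le> exp (t / 2 * x) * (h * x)\<^sup>2"
    using assms mult_right_mono[OF assms(2,1)] by (intro mult_right_mono) (auto simp: abs_mult)
  finally have "exp (- (t * x)) * \<bar>exp (- (h * x)) - (1 + - (h * x))\<bar> \<le>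
      exp (- (t * x)) * (exp (t / 2 * x) * (h * x)\<^sup>2)"
    by (intro mult_left_mono) auto
  also have "\<dots> = h\<^sup>2 * (x\<^sup>2 * (exp (- (t * x)) * exp (t / 2 * x)))"
    by (simp add: power_mult_distrib mult_ac)
  also have "exp (- (t * x)) * exp (t / 2 * x) = exp (- (t / 2 * x))"
    by (simp add: exp_add[symmetric] field_simps)
  also have "exp (- (t * x)) * \<bar>exp (- (h * x)) - (1 + - (h * x))\<bar> =
      \<bar>exp (- (t * x)) * (exp (- (h * x)) - (1 + - (h * x)))\<bar>"
    by (simp add: abs_mult)
  also have "exp (- (t * x)) * (exp (- (h * x)) - (1 + - (h * x))) =
      exp (- ((t + h) * x)) - exp (- (t * x)) + h * (x * exp (- (t * x)))"
  proof -
    have "exp (- ((t + h) * x)) = exp (- (t * x)) * exp (- (h * x))"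
      by (simp add: exp_add[symmetric] algebra_simps)
    then show ?thesis
      by (simp add: algebra_simps)
  qed
  finally show ?thesis .
qed

lemma has_real_derivative_quadratic_remainder:
  fixes f :: "real \<Rightarrow> real"
  assumes "0 < r" and "\<And>h. \<bar>h\<bar> \<le> r \<Longrightarrow> \<bar>f (t + h) - f t - h * D\<bar> \<le> B * h\<^sup>2"
  shows "(f has_real_derivative D) (at t)"
  unfolding DERIV_def
proof (rule Lim_null[THEN iffD2], rule Lim_null_comparison)
  show "((\<lambda>h. B * \<bar>h\<bar>) \<longlongrightarrow> 0) (at 0)"
    by (auto intro!: tendsto_eq_intros)
  have "eventually (\<lambda>h. \<bar>h\<bar> < r \<and> h \<noteq> 0) (at (0::real))"
    using assms(1) by (auto simp: eventually_at intro!: exI[of _ r])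
  then show "eventually (\<lambda>h. norm ((f (t + h) - f t) / h - D) \<le> B * \<bar>h\<bar>) (at 0)"
  proof eventually_elim
    case (elim h)
    have "(f (t + h) - f t) / h - D = (f (t + h) - f t - h * D) / h"
      using elim by (simp add: diff_divide_distrib)
    then have "norm ((f (t + h) - f t) / h - D) = \<bar>f (t + h) - f t - h * D\<bar> / \<bar>h\<bar>"
      by (simp add: abs_divide)
    also have "\<dots> \<le> B * h\<^sup>2 / \<bar>h\<bar>"
      using assms(2)[of h] elim by (intro divide_right_mono) auto
    also have "\<dots> = B * \<bar>h\<bar>"
      using elim by (cases "0 < h") (simp_all add: power2_eq_square)
    finally show ?case .
  qed
qed

section \<open>Differentiation of damped moments under the expectation\<close>

context prob_space
begin

lemma integrable_laplace_moment:
  assumes [measurable]: "Z \<in> borel_measurable M" and Z: "AE \<omega> in M. 0 \<le> Z \<omega>" and "(0::real) < t"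
  shows "integrable M (\<lambda>\<omega>. Z \<omega> ^ k * exp (- (t * Z \<omega>)))"
proof (rule integrable_const_bound[where B="fact k / t ^ k"])
  show "AE \<omega> in M. norm (Z \<omega> ^ k * exp (- (t * Z \<omega>))) \<le> fact k / t ^ k"
    using Z
  proof eventually_elim
    case (elim \<omega>)
    then show ?case
      using power_mult_exp_bound[OF elim \<open>0 < t\<close>, of k] by simp
  qed
qed measurable

text \<open>The pointwise remainder is at most \<open>h\<^sup>2\<close> times
  \<open>Z \<omega> ^ (k + 2) * exp (- (t / 2 * Z \<omega>))\<close>, an integrable variable
  independent of \<open>h\<close>, so the remainder of the expectation is quadratic in
  \<open>h\<close>.\<close>

lemma has_derivative_laplace_moment:
  assumes [measurable]: "Z \<in> borel_measurable M" and Z: "\<And>\<omega>. 0 \<le> Z \<omega>" and "(0::real) < t"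
  shows "((\<lambda>t. expectation (\<lambda>\<omega>. Z \<omega> ^ k * exp (- (t * Z \<omega>)))) has_real_derivative
    - expectation (\<lambda>\<omega>. Z \<omega> ^ Suc k * exp (- (t * Z \<omega>)))) (at t)"
proof (rule has_real_derivative_quadratic_remainder)
  show "0 < t / 2"
    using assms by simp
  fix h :: real assume h: "\<bar>h\<bar> \<le> t / 2"
  have int: "integrable M (\<lambda>\<omega>. Z \<omega> ^ j * exp (- (s * Z \<omega>)))" if "0 < s" for s j
    using that Z by (intro integrable_laplace_moment) auto
  have "0 < t + h"
    using h \<open>0 < t\<close> by linarith
  define R where "R = (\<lambda>\<omega>. Z \<omega> ^ k * exp (- ((t + h) * Z \<omega>)) - Z \<omega> ^ k * exp (- (t * Z \<omega>)) -
      h * - (Z \<omega> ^ Suc k * exp (- (t * Z \<omega>))))"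
  have int_R: "integrable M R"
    unfolding R_def using \<open>0 < t + h\<close> \<open>0 < t\<close>
    by (intro Bochner_Integration.integrable_diff integrable_mult_right integrable_minus int)
  have R_bound: "\<bar>R \<omega>\<bar> \<le> h\<^sup>2 * (Z \<omega> ^ (k + 2) * exp (- (t / 2 * Z \<omega>)))" for \<omega>
  proof -
    have "R \<omega> = Z \<omega> ^ k * (exp (- ((t + h) * Z \<omega>)) - exp (- (t * Z \<omega>)) + h * (Z \<omega> * exp (- (t * Z \<omega>))))"
      by (simp add: R_def algebra_simps)
    then have "\<bar>R \<omega>\<bar> = Z \<omega> ^ k *
        \<bar>exp (- ((t + h) * Z \<omega>)) - exp (- (t * Z \<omega>)) + h * (Z \<omega> * exp (- (t * Z \<omega>)))\<bar>"
      using Z[of \<omega>] by (simp add: abs_mult)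
    also have "\<dots> \<le> Z \<omega> ^ k * (h\<^sup>2 * ((Z \<omega>)\<^sup>2 * exp (- (t / 2 * Z \<omega>))))"
      using Z[of \<omega>] h by (intro mult_left_mono exp_linear_remainder) auto
    finally show ?thesis
      by (simp add: power_add mult_ac power2_eq_square)
  qed
  have "expectation (\<lambda>\<omega>. Z \<omega> ^ k * exp (- ((t + h) * Z \<omega>))) - expectation (\<lambda>\<omega>. Z \<omega> ^ k * exp (- (t * Z \<omega>))) -
      h * - expectation (\<lambda>\<omega>. Z \<omega> ^ Suc k * exp (- (t * Z \<omega>))) = expectation R"
    unfolding R_def using int[OF \<open>0 < t + h\<close>, of k] int[OF \<open>0 < t\<close>, of k] int[OF \<open>0 < t\<close>, of "Suc k"]
    by (subst Bochner_Integration.integral_diff Bochner_Integration.integral_diff; simp)+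
  also have "\<bar>expectation R\<bar> \<le> expectation (\<lambda>\<omega>. \<bar>R \<omega>\<bar>)"
    by (rule integral_abs_bound)
  also have "\<dots> \<le> expectation (\<lambda>\<omega>. h\<^sup>2 * (Z \<omega> ^ (k + 2) * exp (- (t / 2 * Z \<omega>))))"
    using int_R int[of "t / 2" "k + 2"] \<open>0 < t\<close> R_bound by (intro integral_mono) auto
  finally show "\<bar>expectation (\<lambda>\<omega>. Z \<omega> ^ k * exp (- ((t + h) * Z \<omega>))) - expectation (\<lambda>\<omega>. Z \<omega> ^ k * exp (- (t * Z \<omega>))) -
      h * - expectation (\<lambda>\<omega>. Z \<omega> ^ Suc k * exp (- (t * Z \<omega>)))\<bar> \<le>
      expectation (\<lambda>\<omega>. Z \<omega> ^ (k + 2) * exp (- (t / 2 * Z \<omega>))) * h\<^sup>2"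
    by (simp add: mult.commute)
qed

end

text \<open>The \<open>k\<close>-th derivative of \<open>exp (- c t powr d)\<close> in \<open>t\<close> is
  \<open>exp (- x) * poly (stable_poly d k) x / t ^ k\<close> with \<open>x = c t powr d\<close>; the recursion uses
  that \<open>x\<close> has derivative \<open>d * x / t\<close>.\<close>

fun stable_poly :: "real \<Rightarrow> nat \<Rightarrow> real poly" where
  "stable_poly d 0 = 1"
| "stable_poly d (Suc k) = smult (- real k) (stable_poly d k) +
     smult d (pCons 0 (pderiv (stable_poly d k) - stable_poly d k))"

lemma poly_stable_poly_0: "poly (stable_poly d k) 0 = (if k = 0 then 1 else 0)"
  by (induction k) auto

text \<open>The left side is the slope at 0 of \<open>exp (- x) * poly (stable_poly d k) x\<close>.
  To first order in \<open>c\<close>, the function \<open>exp (- (c * t powr d))\<close> is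
  \<open>1 - c * t powr d\<close>, and the \<open>k\<close>-th derivative of \<open>t powr d\<close>
  carries the falling factorial \<open>(- 1) ^ k * pochhammer (- d) k\<close>.\<close>

lemma poly_pderiv_stable_poly_0:
  "poly (pderiv (stable_poly d k) - stable_poly d k) 0 = - ((- 1) ^ k * pochhammer (- d) k)"
proof (induction k)
  case (Suc k)
  have "poly (pderiv (stable_poly d (Suc k)) - stable_poly d (Suc k)) 0 =
      - real k * poly (pderiv (stable_poly d k)) 0 +
      d * poly (pderiv (stable_poly d k) - stable_poly d k) 0"
    by (simp add: pderiv_add pderiv_diff pderiv_smult pderiv_pCons poly_stable_poly_0)
  \<comment> \<open>Subtracting the constant term is harmless: it vanishes for \<open>k > 0\<close>,
    and for \<open>k = 0\<close> the factor \<open>real k\<close> does.\<close>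
  also have "- real k * poly (pderiv (stable_poly d k)) 0 =
      - real k * poly (pderiv (stable_poly d k) - stable_poly d k) 0"
    by (simp add: poly_stable_poly_0)
  finally show ?case
    unfolding Suc by (simp add: pochhammer_Suc algebra_simps)
qed (simp add: pderiv_1)

text \<open>With the sign \<open>(- 1) ^ k\<close> included, each function has minus its successor
  as derivative, exactly as the damped moments in \<open>has_derivative_laplace_moment\<close>
  do.\<close>

lemma has_derivative_stable_poly:
  assumes "0 < (t::real)"
  shows "((\<lambda>t. (- 1) ^ k * inverse (t ^ k) * (exp (- (c * t powr d)) * poly (stable_poly d k) (c * t powr d)))
    has_real_derivative
    - ((- 1) ^ Suc k * inverse (t ^ Suc k) * (exp (- (c * t powr d)) * poly (stable_poly d (Suc k)) (c * t powr d)))) (at t)"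
proof -
  define x where "x = c * t powr d"
  have x: "((\<lambda>t. c * t powr d) has_real_derivative d * x / t) (at t)"
    using assms by (auto intro!: derivative_eq_intros simp: x_def powr_diff)
  have e: "((\<lambda>t. exp (- (c * t powr d))) has_real_derivative exp (- x) * - (d * x / t)) (at t)"
    using DERIV_fun_exp[OF DERIV_minus[OF x]] by (simp add: x_def)
  have p: "((\<lambda>t. poly (stable_poly d k) (c * t powr d)) has_real_derivative
      poly (pderiv (stable_poly d k)) x * (d * x / t)) (at t)"
    using DERIV_chain2[OF poly_DERIV x] by (simp add: x_def)
  have i: "((\<lambda>t. inverse (t ^ k)) has_real_derivative - (real k * inverse (t ^ Suc k))) (at t)"
  proof (cases k)
    case (Suc j)
    show ?thesis
      unfolding Suc
      by (rule DERIV_cong[OF DERIV_inverse_fun[OF DERIV_power_Suc[OF DERIV_ident, where n=j]]])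
        (use assms in \<open>simp_all add: field_simps\<close>)
  qed simp
  have "((\<lambda>t. (- 1) ^ k * (inverse (t ^ k) * (exp (- (c * t powr d)) * poly (stable_poly d k) (c * t powr d))))
      has_real_derivative
      (- 1) ^ k * (- (real k * inverse (t ^ Suc k)) * (exp (- x) * poly (stable_poly d k) x) +
        ((exp (- x) * - (d * x / t)) * poly (stable_poly d k) x +
          (poly (pderiv (stable_poly d k)) x * (d * x / t)) * exp (- x)) * inverse (t ^ k))) (at t)"
    using DERIV_cmult[OF DERIV_mult[OF i DERIV_mult[OF e p]], of "(- 1) ^ k"] by (simp only: x_def)
  moreover have "(- 1) ^ k * (- (real k * inverse (t ^ Suc k)) * (exp (- x) * poly (stable_poly d k) x) +
        ((exp (- x) * - (d * x / t)) * poly (stable_poly d k) x +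
          (poly (pderiv (stable_poly d k)) x * (d * x / t)) * exp (- x)) * inverse (t ^ k)) =
      - ((- 1) ^ Suc k * inverse (t ^ Suc k) * (exp (- x) * poly (stable_poly d (Suc k)) x))"
    using assms by (simp add: field_simps)
  ultimately show ?thesis
    by (simp only: x_def mult.assoc)
qed

context interference
begin

text \<open>As \<open>e\<close> tends to 0 from above, \<open>exp_neg (e * total \<omega>)\<close>
  tends to 1 where the total is finite and stays 0 where it is infinite. By dominated convergence
  the probability of finiteness is the limit of the transforms, which is 1.\<close>

lemma AE_total_finite: "AE \<omega> in M. total \<omega> < top"
proof -
  define e where "e = (\<lambda>i. inverse (real (Suc i)))"
  have e_pos: "0 < e i" for i
    by (simp add: e_def)
  have e_lim: "e \<longlonglongrightarrow> 0"
    unfolding e_def by (rule LIMSEQ_inverse_real_of_nat)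
  define A where "A = {\<omega> \<in> space M. total \<omega> < top}"
  have A_sets [measurable]: "A \<in> sets M"
    unfolding A_def by measurable
  have "(\<lambda>i. \<integral>\<^sup>+\<omega>. ennreal (exp_neg (ennreal (e i) * total \<omega>)) \<partial>M) \<longlonglongrightarrow> (\<integral>\<^sup>+\<omega>. indicator A \<omega> \<partial>M)"
  proof (rule nn_integral_dominated_convergence[where w="\<lambda>_. 1"])
    show "AE \<omega> in M. (\<lambda>i. ennreal (exp_neg (ennreal (e i) * total \<omega>))) \<longlonglongrightarrow> indicator A \<omega>"
    proof (rule AE_I2)
      fix \<omega> assume \<omega>: "\<omega> \<in> space M"
      show "(\<lambda>i. ennreal (exp_neg (ennreal (e i) * total \<omega>))) \<longlonglongrightarrow> indicator A \<omega>"
      proof (cases "total \<omega>")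
        case (real r)
        have "(\<lambda>i. ennreal (exp (- (e i * r)))) \<longlonglongrightarrow> ennreal (exp (- (0 * r)))"
          by (intro tendsto_ennrealI tendsto_intros e_lim)
        moreover have "exp_neg (ennreal (e i) * total \<omega>) = exp (- (e i * r))" for i
          using real e_pos[of i] by (simp add: ennreal_mult[symmetric])
        ultimately show ?thesis
          using real \<omega> by (simp add: A_def)
      next
        case top
        moreover have "ennreal (e i) \<noteq> 0" for i
          using e_pos[of i] by (simp add: ennreal_eq_0_iff not_le)
        ultimately show ?thesis
          by (simp add: A_def ennreal_mult_top)
      qed
    qed
  qed (auto simp: emeasure_space_1)
  moreover have "(\<lambda>i. e i powr (2 / \<alpha>)) \<longlonglongrightarrow> 0 powr (2 / \<alpha>)"
    using \<alpha>_gt_2 e_pos by (intro tendsto_powr2 e_lim tendsto_const) (auto simp: less_imp_le)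
  then have "(\<lambda>i. \<integral>\<^sup>+\<omega>. ennreal (exp_neg (ennreal (e i) * total \<omega>)) \<partial>M) \<longlonglongrightarrow> ennreal (exp (- (\<mu> * (rate * 0))))"
    unfolding laplace_total_ennreal[OF e_pos]
    by (intro tendsto_ennrealI tendsto_exp tendsto_minus tendsto_mult_left) simp
  ultimately have "(\<integral>\<^sup>+\<omega>. indicator A \<omega> \<partial>M) = ennreal (exp (- (\<mu> * (rate * 0))))"
    by (rule LIMSEQ_unique)
  then have "prob A = 1"
    by (simp add: emeasure_eq_measure)
  then have "AE \<omega> in M. \<omega> \<in> A"
    by (simp add: prob_eq_1)
  then show ?thesis
    by eventually_elim (simp add: A_def)
qed

definition interference_power :: "'w \<Rightarrow> real" where
  "interference_power \<omega> = enn2real (total \<omega>)"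

lemma interference_power_nonneg [simp]: "0 \<le> interference_power \<omega>"
  by (simp add: interference_power_def)

lemma measurable_interference_power [measurable]: "interference_power \<in> borel_measurable M"
  unfolding interference_power_def by measurable

text \<open>The real series occurring in \<open>sinr\<close> is tied to the extended sum only where
  it is summable, which finiteness of \<open>total\<close> and positivity of the marks
  ensure.\<close>

lemma AE_interference_power_eq:
  "AE \<omega> in M. interference_power \<omega> = (\<Sum>l. term_at l \<omega>)"
  using AE_total_finite AE_marks_pos
proof eventually_elim
  case (elim \<omega>)
  have nonneg: "0 \<le> term_at l \<omega>" for l
    using elim(2) by (simp add: less_imp_le)
  have "summable (\<lambda>l. term_at l \<omega>)"
    using elim(1) nonneg unfolding total_def by (intro summable_suminf_not_top) auto
  then have "total \<omega> = ennreal (\<Sum>l. term_at l \<omega>)"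
    unfolding total_def using nonneg by (intro suminf_ennreal2)
  then show ?case
    using nonneg \<open>summable (\<lambda>l. term_at l \<omega>)\<close> by (simp add: interference_power_def suminf_nonneg)
qed

lemma laplace_interference_power:
  assumes "0 < t"
  shows "expectation (\<lambda>\<omega>. exp (- (t * interference_power \<omega>))) = exp (- (\<mu> * rate * t powr (2 / \<alpha>)))"
proof -
  have "(\<integral>\<^sup>+\<omega>. ennreal (exp (- (t * interference_power \<omega>))) \<partial>M) =
      (\<integral>\<^sup>+\<omega>. ennreal (exp_neg (ennreal t * total \<omega>)) \<partial>M)"
  proof (intro nn_integral_cong_AE, use AE_total_finite in eventually_elim)
    case (elim \<omega>)
    then have "total \<omega> = ennreal (interference_power \<omega>)"
      by (simp add: interference_power_def)
    then show ?case
      using assms by (simp add: ennreal_mult[symmetric])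
  qed
  then show ?thesis
    by (simp add: integral_eq_nn_integral laplace_total_ennreal[OF assms] mult.assoc)
qed

text \<open>The induction hypothesis is an identity between functions on the open half-line, so it
  may be differentiated; uniqueness of the derivative yields the next moment.\<close>

lemma moment_interference_power:
  assumes "0 < t"
  shows "expectation (\<lambda>\<omega>. interference_power \<omega> ^ k * exp (- (t * interference_power \<omega>))) =
    (- 1) ^ k * inverse (t ^ k) *
      (exp (- (\<mu> * rate * t powr (2 / \<alpha>))) * poly (stable_poly (2 / \<alpha>) k) (\<mu> * rate * t powr (2 / \<alpha>)))"
  using assms
proof (induction k arbitrary: t)
  case 0
  then show ?case
    by (simp add: laplace_interference_power)
next
  case (Suc k)
  let ?G = "\<lambda>k t. expectation (\<lambda>\<omega>. interference_power \<omega> ^ k * exp (- (t * interference_power \<omega>)))"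
  let ?H = "\<lambda>k t. (- 1) ^ k * inverse (t ^ k) *
      (exp (- (\<mu> * rate * t powr (2 / \<alpha>))) * poly (stable_poly (2 / \<alpha>) k) (\<mu> * rate * t powr (2 / \<alpha>)))"
  have "(?G k has_real_derivative - ?G (Suc k) t) (at t)"
    using Suc.prems by (intro has_derivative_laplace_moment) auto
  moreover have "(?G k has_real_derivative - ?H (Suc k) t) (at t)"
    by (rule has_field_derivative_transform_within_open[OF has_derivative_stable_poly[OF Suc.prems], of "{0<..}"])
      (use Suc.prems Suc.IH in simp_all)
  ultimately have "- ?G (Suc k) t = - ?H (Suc k) t"
    by (rule DERIV_unique)
  then show ?case
    by (simp only: neg_equal_iff_equal)
qed

lemma scaled_moment_interference_power:
  assumes "0 < s"
  shows "expectation (\<lambda>\<omega>. (s * interference_power \<omega>) ^ k * exp (- (s * interference_power \<omega>))) =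
    (- 1) ^ k * (exp (- (\<mu> * rate * s powr (2 / \<alpha>))) *
      poly (stable_poly (2 / \<alpha>) k) (\<mu> * rate * s powr (2 / \<alpha>)))"
  using moment_interference_power[OF assms, of k] assms
  by (simp add: power_mult_distrib mult.assoc)

text \<open>Vanishing interference would have transform 1 at \<open>t = 1\<close>, whereas
  \<open>exp (- (\<mu> * rate))\<close> is smaller. This supplies the strictness in
  \<open>single_user_outage_less\<close>.\<close>

lemma not_AE_interference_power_0: "\<not> (AE \<omega> in M. interference_power \<omega> = 0)"
proof
  assume "AE \<omega> in M. interference_power \<omega> = 0"
  then have "expectation (\<lambda>\<omega>. exp (- (1 * interference_power \<omega>))) = expectation (\<lambda>_. 1)"
    by (intro integral_cong_AE) (auto elim!: eventually_mono)
  then show False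
    using laplace_interference_power[of 1] \<mu>_pos rate_pos prob_space by simp
qed

lemma interference_power_others:
  assumes "i = Signal \<or> i = Self_Interference"
  shows "interference_power \<in> borel_measurable (others i)"
proof -
  have [measurable]: "X l \<in> borel_measurable (others i)" "\<Psi> l \<in> borel_measurable (others i)" for l
    using assms by (auto intro!: points_measurable measurable_others)
  show ?thesis
    unfolding interference_power_def total_def by measurable
qed

end

section \<open>Outage probability\<close>

text \<open>The survival function of \<open>Gamma(m, 1)\<close> at \<open>x \<ge> 0\<close>.\<close>

definition gamma_tail :: "nat \<Rightarrow> real \<Rightarrow> real" where
  "gamma_tail m x = (\<Sum>k<m. x ^ k * exp (- x) / fact k)"

lemma measurable_gamma_tail [measurable]: "gamma_tail m \<in> borel_measurable borel"
  unfolding gamma_tail_def[abs_def] by measurable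

lemma gamma_tail_nonneg: "0 \<le> x \<Longrightarrow> 0 \<le> gamma_tail m x"
  unfolding gamma_tail_def by (intro sum_nonneg) simp

lemma gamma_tail_Suc: "gamma_tail (Suc k) x = gamma_tail k x + x ^ k * exp (- x) / fact k"
  by (simp add: gamma_tail_def)

text \<open>The derivatives of consecutive terms telescope, leaving minus the density of the gamma
  law with shape \<open>k + 1\<close> and unit scale.\<close>

lemma gamma_tail_has_derivative:
  "(gamma_tail (Suc k) has_real_derivative - (x ^ k * exp (- x) / fact k)) (at x)"
proof (induction k)
  case 0
  have "gamma_tail (Suc 0) = (\<lambda>x. exp (- x))"
    by (auto simp: gamma_tail_def)
  then show ?case
    by (auto intro!: derivative_eq_intros)
next
  case (Suc k)
  have "((\<lambda>x. gamma_tail (Suc k) x + x ^ Suc k * exp (- x) / fact (Suc k)) has_real_derivative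
      - (x ^ k * exp (- x) / fact k) +
      (((1 + real k) * (1 * x ^ k)) * exp (- x) + (exp (- x) * - 1) * x ^ Suc k) / fact (Suc k)) (at x)"
    by (intro DERIV_add Suc DERIV_cdivide DERIV_mult DERIV_power_Suc DERIV_ident DERIV_fun_exp DERIV_minus)
  moreover have "- (x ^ k * exp (- x) / fact k) +
      (((1 + real k) * (1 * x ^ k)) * exp (- x) + (exp (- x) * - 1) * x ^ Suc k) / fact (Suc k) =
      - (x ^ Suc k * exp (- x) / fact (Suc k))"
    by (simp add: fact_Suc add_divide_distrib diff_divide_distrib)
  ultimately show ?case
    by (simp only: gamma_tail_Suc[of "Suc k", abs_def])
qed

lemma gamma_tail_strict_antimono:
  assumes "0 < m" "0 \<le> x" "x < y"
  shows "gamma_tail m y < gamma_tail m x"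
proof -
  obtain k where m: "m = Suc k"
    using assms(1) gr0_implies_Suc by blast
  show ?thesis
    unfolding m
  \<comment> \<open>The open-interval version matters: for \<open>k > 0\<close> the derivative
    vanishes at 0, which is an admissible left endpoint.\<close>
  proof (rule DERIV_neg_imp_decreasing_open[OF assms(3)])
    fix z assume "x < z" "z < y"
    then have "- (z ^ k * exp (- z) / fact k) < 0"
      using assms(2) by simp
    then show "\<exists>D. (gamma_tail (Suc k) has_real_derivative D) (at z) \<and> D < 0"
      using gamma_tail_has_derivative by blast
  next
    show "continuous_on {x..y} (gamma_tail (Suc k))"
      by (intro continuous_at_imp_continuous_on ballI DERIV_isCont[OF gamma_tail_has_derivative])
  qed
qed

lemma gamma_tail_0: "0 < m \<Longrightarrow> gamma_tail m 0 = 1"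
proof -
  assume "0 < m"
  then obtain k where m: "m = Suc k"
    using gr0_implies_Suc by blast
  show ?thesis
    unfolding m by (induction k) (auto simp: gamma_tail_def)
qed

lemma gamma_tail_le_1: "0 < m \<Longrightarrow> 0 \<le> x \<Longrightarrow> gamma_tail m x \<le> 1"
  using gamma_tail_strict_antimono[of m 0 x] gamma_tail_0[of m] by (cases "x = 0") auto

lemma erlang_CDF_eq_gamma_tail:
  "0 \<le> l \<Longrightarrow> 0 \<le> x \<Longrightarrow> erlang_CDF k l x = 1 - gamma_tail (Suc k) (l * x)"
  by (simp add: erlang_CDF_def gamma_tail_def lessThan_Suc_atMost)

lemma gamma_distributed_imp_erlang:
  assumes "gamma_distributed M Z (real (Suc k)) s" "0 < s"
  shows "distributed M lborel Z (erlang_density k (1 / s))"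
proof -
  \<comment> \<open>The point 0 is excluded because for \<open>k = 0\<close> the Erlang density is
    positive there, while \<open>gamma_density\<close> is 0.\<close>
  have "AE x in lborel. ennreal (gamma_density (real (Suc k)) s x) = ennreal (erlang_density k (1 / s) x)"
    using AE_lborel_singleton[of 0]
  proof eventually_elim
    case (elim x)
    have "Gamma (1 + real k) = fact k"
      by (rule Gamma_fact)
    moreover have "s powr (1 + real k) = s ^ Suc k"
      using assms(2) powr_realpow[of s "Suc k"] by (simp only: of_nat_Suc)
    ultimately show ?case
      using elim assms(2)
      by (auto simp: gamma_density_def erlang_density_def powr_realpow power_divide field_simps)
  qed
  then show ?thesis
    using assms(1) unfolding gamma_distributed_def
    by (subst (asm) distributed_cong_density) auto
qed

lemma (in prob_space) integrable_gamma_tail: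
  assumes [measurable]: "Z \<in> borel_measurable M" and "AE \<omega> in M. 0 \<le> Z \<omega>" "0 < m"
  shows "integrable M (\<lambda>\<omega>. gamma_tail m (Z \<omega>))"
proof (rule integrable_const_bound[where B=1])
  show "AE \<omega> in M. norm (gamma_tail m (Z \<omega>)) \<le> 1"
    using assms(2) by eventually_elim (simp add: gamma_tail_nonneg gamma_tail_le_1[OF assms(3)])
qed measurable

lemma nn_integral_if:
  assumes [measurable]: "Measurable.pred M P"
  shows "(\<integral>\<^sup>+x. (if P x then 1 else 0) \<partial>M) = emeasure M {x \<in> space M. P x}"
proof -
  have "(\<integral>\<^sup>+x. (if P x then 1 else 0) \<partial>M) = (\<integral>\<^sup>+x. indicator {x \<in> space M. P x} x \<partial>M)"
    by (intro nn_integral_cong) (simp add: indicator_def)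
  also have "\<dots> = emeasure M {x \<in> space M. P x}"
    by (rule nn_integral_indicator) measurable
  finally show ?thesis .
qed

context independent_sources
begin

text \<open>With all other sources held fixed, the probability of
  \<open>W \<omega> \<le> \<beta> * Z \<omega>\<close> is the distribution function of
  \<open>W\<close> at a constant. Stated for a general \<open>Z\<close>, it covers both the
  single-user denominator and the one with interference.\<close>

lemma outage_gamma_tail:
  assumes W: "gamma_distributed M W (real m) \<theta>" and "0 < m" "0 < \<theta>" "0 < \<beta>"
    and Z [measurable]: "Z \<in> borel_measurable (others Signal)" and Z_nonneg: "AE \<omega> in M. 0 \<le> Z \<omega>"
  shows "prob {\<omega> \<in> space M. W \<omega> \<le> \<beta> * Z \<omega>} = 1 - expectation (\<lambda>\<omega>. gamma_tail m (\<beta> / \<theta> * Z \<omega>))"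
proof -
  obtain k where m: "m = Suc k"
    using \<open>0 < m\<close> gr0_implies_Suc by blast
  have Z_M [measurable]: "Z \<in> borel_measurable M"
    by (rule measurable_from_subalg[OF subalgebra_others Z])
  have erlang: "distributed M lborel W (erlang_density k (1 / \<theta>))"
    using W \<open>0 < \<theta>\<close> unfolding m by (rule gamma_distributed_imp_erlang)
  have CDF: "emeasure M {\<omega> \<in> space M. W \<omega> \<le> a} = ennreal (1 - gamma_tail m (a / \<theta>))" if "0 \<le> a" for a
    using erlang_distributed_le[OF erlang _ that] that \<open>0 < \<theta>\<close>
    by (simp add: emeasure_eq_measure erlang_CDF_eq_gamma_tail m)
  have nonneg: "AE \<omega> in M. 0 \<le> \<beta> / \<theta> * Z \<omega>"
    using Z_nonneg by eventually_elim (use assms in simp)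
  have int: "integrable M (\<lambda>\<omega>. gamma_tail m (\<beta> / \<theta> * Z \<omega>))"
    using nonneg \<open>0 < m\<close> by (intro integrable_gamma_tail) auto
  have "emeasure M {\<omega> \<in> space M. W \<omega> \<le> \<beta> * Z \<omega>} =
      (\<integral>\<^sup>+\<omega>. (if W \<omega> \<le> \<beta> * Z \<omega> then 1 else 0) \<partial>M)"
    by (rule nn_integral_if[symmetric]) measurable
  also have "\<dots> = (\<integral>\<^sup>+\<omega>. (\<integral>\<^sup>+\<omega>'. (if W \<omega>' \<le> \<beta> * Z \<omega> then 1 else 0) \<partial>M) \<partial>M)"
    by (rule nn_integral_indep_source[of Signal W "\<lambda>\<omega> w. if w \<le> \<beta> * Z \<omega> then 1 else 0"]) auto
  also have "\<dots> = (\<integral>\<^sup>+\<omega>. ennreal (1 - gamma_tail m (\<beta> / \<theta> * Z \<omega>)) \<partial>M)"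
  proof (intro nn_integral_cong_AE, use Z_nonneg in eventually_elim)
    case (elim \<omega>)
    have "(\<integral>\<^sup>+\<omega>'. (if W \<omega>' \<le> \<beta> * Z \<omega> then 1 else 0) \<partial>M) = emeasure M {\<omega>' \<in> space M. W \<omega>' \<le> \<beta> * Z \<omega>}"
      by (rule nn_integral_if) measurable
    also have "\<dots> = ennreal (1 - gamma_tail m (\<beta> * Z \<omega> / \<theta>))"
      using elim \<open>0 < \<beta>\<close> by (intro CDF) simp
    finally show ?case by simp
  qed
  finally have eq: "ennreal (prob {\<omega> \<in> space M. W \<omega> \<le> \<beta> * Z \<omega>}) =
      (\<integral>\<^sup>+\<omega>. ennreal (1 - gamma_tail m (\<beta> / \<theta> * Z \<omega>)) \<partial>M)"
    by (simp only: emeasure_eq_measure)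
  have "prob {\<omega> \<in> space M. W \<omega> \<le> \<beta> * Z \<omega>} = expectation (\<lambda>\<omega>. 1 - gamma_tail m (\<beta> / \<theta> * Z \<omega>))"
  proof (subst integral_eq_nn_integral)
    show "AE \<omega> in M. 0 \<le> 1 - gamma_tail m (\<beta> / \<theta> * Z \<omega>)"
      using nonneg by eventually_elim (use gamma_tail_le_1[OF \<open>0 < m\<close>] in auto)
  qed (use eq[symmetric] in simp_all)
  also have "\<dots> = 1 - expectation (\<lambda>\<omega>. gamma_tail m (\<beta> / \<theta> * Z \<omega>))"
    using int by (simp add: prob_space)
  finally show ?thesis .
qed

lemma
  fixes a :: "real \<Rightarrow> real"
  assumes [measurable]: "a \<in> borel_measurable borel"
    and B: "B \<in> borel_measurable (others Self_Interference)"
    and a_int: "integrable M (\<lambda>\<omega>. a (Y \<omega>))" and B_int: "integrable M B"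
    and a_nonneg: "AE \<omega> in M. 0 \<le> a (Y \<omega>)" and B_nonneg: "\<And>\<omega>. 0 \<le> B \<omega>"
  shows integrable_mult_Y: "integrable M (\<lambda>\<omega>. a (Y \<omega>) * B \<omega>)"
    and expectation_mult_Y: "expectation (\<lambda>\<omega>. a (Y \<omega>) * B \<omega>) = expectation (\<lambda>\<omega>. a (Y \<omega>)) * expectation B"
proof -
  note [measurable] = B
  have [measurable]: "B \<in> borel_measurable M"
    by (rule measurable_from_subalg[OF subalgebra_others B])
  have "(\<integral>\<^sup>+\<omega>. ennreal (a (Y \<omega>) * B \<omega>) \<partial>M) = (\<integral>\<^sup>+\<omega>. ennreal (B \<omega>) * ennreal (a (Y \<omega>)) \<partial>M)"
    using B_nonneg by (simp add: ennreal_mult'[symmetric] mult.commute)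
  also have "\<dots> = (\<integral>\<^sup>+\<omega>. (\<integral>\<^sup>+\<omega>'. ennreal (B \<omega>) * ennreal (a (Y \<omega>')) \<partial>M) \<partial>M)"
    by (rule nn_integral_indep_source[of Self_Interference Y "\<lambda>\<omega> y. ennreal (B \<omega>) * ennreal (a y)"]) auto
  also have "\<dots> = (\<integral>\<^sup>+\<omega>. ennreal (B \<omega>) \<partial>M) * (\<integral>\<^sup>+\<omega>. ennreal (a (Y \<omega>)) \<partial>M)"
    by (simp add: nn_integral_cmult nn_integral_multc)
  also have "\<dots> = ennreal (expectation B) * ennreal (expectation (\<lambda>\<omega>. a (Y \<omega>)))"
    using a_int B_int a_nonneg B_nonneg by (simp add: nn_integral_eq_integral)
  also have "\<dots> = ennreal (expectation (\<lambda>\<omega>. a (Y \<omega>)) * expectation B)"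
    using integral_nonneg_AE[OF AE_I2[OF B_nonneg]]
    by (subst ennreal_mult'[symmetric]) (simp_all add: mult.commute)
  finally have "has_bochner_integral M (\<lambda>\<omega>. a (Y \<omega>) * B \<omega>) (expectation (\<lambda>\<omega>. a (Y \<omega>)) * expectation B)"
    using a_nonneg B_nonneg
    by (intro has_bochner_integral_nn_integral)
      (auto intro!: mult_nonneg_nonneg integral_nonneg_AE elim!: eventually_mono)
  then show "integrable M (\<lambda>\<omega>. a (Y \<omega>) * B \<omega>)"
    "expectation (\<lambda>\<omega>. a (Y \<omega>) * B \<omega>) = expectation (\<lambda>\<omega>. a (Y \<omega>)) * expectation B"
    by (simp_all add: has_bochner_integral_iff)
qed

end

text \<open>Divided by \<open>fact k\<close>, this is the mean Poisson probability of
  \<open>k\<close> at the random rate \<open>s * (Y + 1)\<close>. The single-user outage, the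
  success polynomial and the interference factor are all expressed through these numbers, which
  makes them comparable.\<close>

definition shifted_moment :: "'w measure \<Rightarrow> ('w \<Rightarrow> real) \<Rightarrow> real \<Rightarrow> nat \<Rightarrow> real" where
  "shifted_moment M Y s k = (LINT \<omega>|M. (s * (Y \<omega> + 1)) ^ k * exp (- (s * (Y \<omega> + 1))))"

text \<open>The binomial expansion of the powers of \<open>s * (Y + 1) + s * I\<close> under the expectation; \<open>A i\<close> stands
  for the moments of \<open>s * (Y + 1)\<close>, and the sign comes from the derivatives of the Laplace
  transform of \<open>I\<close>.\<close>

definition success_poly :: "real \<Rightarrow> (nat \<Rightarrow> real) \<Rightarrow> nat \<Rightarrow> real poly" where
  "success_poly d A m = (\<Sum>k<m. \<Sum>j\<le>k.
     smult (real (k choose j) / fact k * ((- 1) ^ j * A (k - j))) (stable_poly d j))"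

lemma poly_success_poly_0: "poly (success_poly d A m) 0 = (\<Sum>k<m. A k / fact k)"
proof -
  have "(\<Sum>j\<le>k. real (k choose j) / fact k * ((- 1) ^ j * A (k - j)) * poly (stable_poly d j) 0) =
      A k / fact k" for k
  proof -
    have "(\<Sum>j\<le>k. real (k choose j) / fact k * ((- 1) ^ j * A (k - j)) * poly (stable_poly d j) 0) =
        (\<Sum>j\<in>{0}. real (k choose j) / fact k * ((- 1) ^ j * A (k - j)) * poly (stable_poly d j) 0)"
      by (intro sum.mono_neutral_right) (auto simp: poly_stable_poly_0)
    then show ?thesis
      by simp
  qed
  then show ?thesis
    by (simp add: success_poly_def poly_sum)
qed

lemma integrable_shifted_moment:
  fixes Y :: "'a \<Rightarrow> real"
  assumes "prob_space M" and [measurable]: "Y \<in> borel_measurable M" and "AE \<omega> in M. 0 \<le> Y \<omega>" "0 < s"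
  shows "integrable M (\<lambda>\<omega>. (s * (Y \<omega> + 1)) ^ k * exp (- (s * (Y \<omega> + 1))))"
proof -
  interpret prob_space M by fact
  have "AE \<omega> in M. 0 \<le> s * (Y \<omega> + 1)"
    using assms(3)
  proof eventually_elim
    case (elim \<omega>)
    then show ?case
      using \<open>0 < s\<close> by simp
  qed
  then have "integrable M (\<lambda>\<omega>. (s * (Y \<omega> + 1)) ^ k * exp (- (1 * (s * (Y \<omega> + 1)))))"
    by (intro integrable_laplace_moment) auto
  then show ?thesis by simp
qed

lemma (in independent_sources) single_user_outage_eq_prob:
  assumes "AE \<omega> in M. 0 \<le> Y \<omega>"
  shows "single_user_outage M W Y \<beta> = prob {\<omega> \<in> space M. W \<omega> \<le> \<beta> * (Y \<omega> + 1)}"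
  unfolding single_user_outage_def outage_probability_def
proof (rule finite_measure_eq_AE)
  show "AE \<omega> in M. \<omega> \<in> {\<omega> \<in> space M. W \<omega> / (Y \<omega> + 1) \<le> \<beta>} \<longleftrightarrow>
      \<omega> \<in> {\<omega> \<in> space M. W \<omega> \<le> \<beta> * (Y \<omega> + 1)}"
    using assms by eventually_elim (simp add: pos_divide_le_eq)
qed measurable

lemma (in independent_sources) single_user_outage_moments:
  assumes W: "gamma_distributed M W (real m) \<theta>" and "0 < m" "0 < \<theta>" "0 < \<beta>"
    and Y: "AE \<omega> in M. 0 \<le> Y \<omega>"
  shows "single_user_outage M W Y \<beta> = 1 - (\<Sum>k<m. shifted_moment M Y (\<beta> / \<theta>) k / fact k)"
proof -
  have [measurable]: "Y \<in> borel_measurable (others Signal)"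
    by (rule measurable_others) simp
  have "AE \<omega> in M. 0 \<le> Y \<omega> + 1"
    using Y by eventually_elim simp
  then have "single_user_outage M W Y \<beta> = 1 - expectation (\<lambda>\<omega>. gamma_tail m (\<beta> / \<theta> * (Y \<omega> + 1)))"
    unfolding single_user_outage_eq_prob[OF Y] using W assms by (intro outage_gamma_tail) auto
  also have "expectation (\<lambda>\<omega>. gamma_tail m (\<beta> / \<theta> * (Y \<omega> + 1))) =
      (\<Sum>k<m. shifted_moment M Y (\<beta> / \<theta>) k / fact k)"
    unfolding gamma_tail_def shifted_moment_def
    using integrable_shifted_moment[OF prob_space_axioms _ Y, of "\<beta> / \<theta>"] assms
    by (subst Bochner_Integration.integral_sum) auto
  finally show ?thesis .
qed

context interference
begin

lemma outage_eq_prob: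
  assumes "AE \<omega> in M. 0 \<le> Y \<omega>"
  shows "outage_probability M (sinr \<alpha> W Y X \<Psi>) \<beta> =
    prob {\<omega> \<in> space M. W \<omega> \<le> \<beta> * (Y \<omega> + 1 + interference_power \<omega>)}"
  unfolding outage_probability_def sinr_def
proof (rule finite_measure_eq_AE)
  show "AE \<omega> in M. \<omega> \<in> {\<omega> \<in> space M. W \<omega> / (Y \<omega> + (\<Sum>l. term_at l \<omega>) + 1) \<le> \<beta>} \<longleftrightarrow>
      \<omega> \<in> {\<omega> \<in> space M. W \<omega> \<le> \<beta> * (Y \<omega> + 1 + interference_power \<omega>)}"
    using assms AE_interference_power_eq
  proof eventually_elim
    case (elim \<omega>)
    have "0 < Y \<omega> + interference_power \<omega> + 1"
      using elim(1) interference_power_nonneg[of \<omega>] by linarith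
    then show ?case
      by (simp only: mem_Collect_eq elim(2)[symmetric]) (simp add: pos_divide_le_eq algebra_simps)
  qed
qed measurable

lemma outage_gamma_tail_interference:
  assumes W: "gamma_distributed M W (real m) \<theta>" and "0 < m" "0 < \<theta>" "0 < \<beta>"
    and Y: "AE \<omega> in M. 0 \<le> Y \<omega>"
  shows "outage_probability M (sinr \<alpha> W Y X \<Psi>) \<beta> =
    1 - expectation (\<lambda>\<omega>. gamma_tail m (\<beta> / \<theta> * (Y \<omega> + 1 + interference_power \<omega>)))"
proof -
  have [measurable]: "Y \<in> borel_measurable (others Signal)"
    "interference_power \<in> borel_measurable (others Signal)"
    by (auto intro!: measurable_others interference_power_others)
  have "AE \<omega> in M. 0 \<le> Y \<omega> + 1 + interference_power \<omega>"
    using Y by eventually_elim simp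
  then show ?thesis
    unfolding outage_eq_prob[OF Y] using W assms by (intro outage_gamma_tail) auto
qed

text \<open>The gamma tail decreases strictly and the interference is not almost surely 0. Were the
  two expectations equal, their nonnegative difference of integrands would vanish almost surely, and
  so would the interference.\<close>

lemma single_user_outage_less:
  assumes W: "gamma_distributed M W (real m) \<theta>" and "0 < m" "0 < \<theta>" "0 < \<beta>"
    and Y: "AE \<omega> in M. 0 \<le> Y \<omega>"
  shows "single_user_outage M W Y \<beta> < outage_probability M (sinr \<alpha> W Y X \<Psi>) \<beta>"
proof -
  define s where "s = \<beta> / \<theta>"
  have "0 < s"
    using assms by (simp add: s_def)
  define f where "f = (\<lambda>\<omega>. gamma_tail m (s * (Y \<omega> + 1)))"
  define g where "g = (\<lambda>\<omega>. gamma_tail m (s * (Y \<omega> + 1 + interference_power \<omega>)))"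
  have [measurable]: "Y \<in> borel_measurable (others Signal)"
    by (rule measurable_others) simp
  have Z: "AE \<omega> in M. 0 \<le> Y \<omega> + 1"
    using Y by eventually_elim simp
  have f: "single_user_outage M W Y \<beta> = 1 - expectation f"
    unfolding single_user_outage_eq_prob[OF Y] f_def s_def
    using W assms Z by (intro outage_gamma_tail) auto
  have g: "outage_probability M (sinr \<alpha> W Y X \<Psi>) \<beta> = 1 - expectation g"
    unfolding g_def s_def by (rule outage_gamma_tail_interference) fact+
  have "AE \<omega> in M. 0 \<le> s * (Y \<omega> + 1) \<and> 0 \<le> s * (Y \<omega> + 1 + interference_power \<omega>)"
    using Y
  proof eventually_elim
    case (elim \<omega>)
    then show ?case
      using \<open>0 < s\<close> by simp
  qed
  then have int: "integrable M f" "integrable M g"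
    unfolding f_def g_def using \<open>0 < m\<close> by (auto intro!: integrable_gamma_tail)
  have less: "g \<omega> < f \<omega>" if "0 \<le> Y \<omega>" "interference_power \<omega> \<noteq> 0" for \<omega>
  proof -
    have "0 < interference_power \<omega>"
      using that(2) interference_power_nonneg[of \<omega>] by linarith
    then show ?thesis
      unfolding f_def g_def using that(1) \<open>0 < s\<close> \<open>0 < m\<close>
      by (intro gamma_tail_strict_antimono) simp_all
  qed
  have nonneg: "AE \<omega> in M. 0 \<le> f \<omega> - g \<omega>"
    using Y
  proof eventually_elim
    case (elim \<omega>)
    show ?case
    proof (cases "interference_power \<omega> = 0")
      case True
      then show ?thesis
        by (simp add: f_def g_def)
    next
      case False
      then show ?thesis
        using less[OF elim] by simp
    qed
  qed
  have "expectation (\<lambda>\<omega>. f \<omega> - g \<omega>) \<noteq> 0"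
  proof
    assume "expectation (\<lambda>\<omega>. f \<omega> - g \<omega>) = 0"
    then have "AE \<omega> in M. f \<omega> - g \<omega> = 0"
      by (rule iffD1[OF integral_nonneg_eq_0_iff_AE[OF Bochner_Integration.integrable_diff[OF int] nonneg]])
    then have "AE \<omega> in M. interference_power \<omega> = 0"
      using Y
    proof eventually_elim
      case (elim \<omega>)
      show ?case
      proof (rule ccontr)
        assume "interference_power \<omega> \<noteq> 0"
        then have "g \<omega> < f \<omega>"
          by (rule less[OF elim(2)])
        then show False
          using elim(1) by simp
      qed
    qed
    then show False
      using not_AE_interference_power_0 by simp
  qed
  moreover have "0 \<le> expectation (\<lambda>\<omega>. f \<omega> - g \<omega>)"
    using nonneg by (rule integral_nonneg_AE)
  ultimately show ?thesis
    using int f g by simp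
qed

text \<open>The binomial theorem and the splitting of the exponential write each term of the gamma
  tail as a sum of products of a function of \<open>Y\<close> and a function of the interference.
  Expectations then factor, and every interference moment carries the same factor
  \<open>exp (- x)\<close>.\<close>

lemma outage_formula:
  assumes W: "gamma_distributed M W (real m) \<theta>" and "0 < m" "0 < \<theta>" "0 < \<beta>"
    and Y: "AE \<omega> in M. 0 \<le> Y \<omega>"
  shows "outage_probability M (sinr \<alpha> W Y X \<Psi>) \<beta> =
    1 - exp (- (\<mu> * rate * (\<beta> / \<theta>) powr (2 / \<alpha>))) *
      poly (success_poly (2 / \<alpha>) (shifted_moment M Y (\<beta> / \<theta>)) m) (\<mu> * rate * (\<beta> / \<theta>) powr (2 / \<alpha>))"
proof -
  define s where "s = \<beta> / \<theta>"
  have "0 < s"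
    using assms by (simp add: s_def)
  define x where "x = \<mu> * rate * s powr (2 / \<alpha>)"
  define a where "a = (\<lambda>k y. (s * (y + 1)) ^ k * exp (- (s * (y + 1))))"
  define B where "B = (\<lambda>j \<omega>. (s * interference_power \<omega>) ^ j * exp (- (s * interference_power \<omega>)))"
  have a_meas [measurable]: "a k \<in> borel_measurable borel" for k
    unfolding a_def by measurable
  have a_int: "integrable M (\<lambda>\<omega>. a k (Y \<omega>))" for k
    unfolding a_def using Y \<open>0 < s\<close> by (intro integrable_shifted_moment prob_space_axioms) auto
  have a_exp: "expectation (\<lambda>\<omega>. a k (Y \<omega>)) = shifted_moment M Y s k" for k
    by (simp add: a_def shifted_moment_def)
  have a_nonneg: "AE \<omega> in M. 0 \<le> a k (Y \<omega>)" for k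
    using Y by eventually_elim (use \<open>0 < s\<close> in \<open>simp add: a_def\<close>)
  have B_meas: "B j \<in> borel_measurable (others Self_Interference)" for j
  proof -
    have [measurable]: "interference_power \<in> borel_measurable (others Self_Interference)"
      by (rule interference_power_others) simp
    show ?thesis
      unfolding B_def by measurable
  qed
  have B_int: "integrable M (B j)" for j
  proof -
    have "integrable M (\<lambda>\<omega>. (s * interference_power \<omega>) ^ j * exp (- (1 * (s * interference_power \<omega>))))"
      using \<open>0 < s\<close> by (intro integrable_laplace_moment) auto
    then show ?thesis
      by (simp add: B_def)
  qed
  have B_exp: "expectation (B j) = (- 1) ^ j * (exp (- x) * poly (stable_poly (2 / \<alpha>) j) x)" for j
    unfolding B_def x_def by (rule scaled_moment_interference_power) fact
  have B_nonneg: "0 \<le> B j \<omega>" for j \<omega>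
    using \<open>0 < s\<close> by (simp add: B_def)
  note mult_int = integrable_mult_Y[OF a_meas B_meas a_int B_int a_nonneg B_nonneg]
  note mult_exp = expectation_mult_Y[OF a_meas B_meas a_int B_int a_nonneg B_nonneg]
  have expand: "gamma_tail m (s * (Y \<omega> + 1 + interference_power \<omega>)) =
      (\<Sum>k<m. \<Sum>j\<le>k. real (k choose j) / fact k * (a (k - j) (Y \<omega>) * B j \<omega>))" for \<omega>
    unfolding gamma_tail_def
  proof (intro sum.cong refl)
    fix k
    let ?U = "s * (Y \<omega> + 1)" and ?V = "s * interference_power \<omega>"
    have UV: "s * (Y \<omega> + 1 + interference_power \<omega>) = ?V + ?U"
      by (simp add: algebra_simps)
    have "(?V + ?U) ^ k * exp (- (?V + ?U)) / fact k =
        (\<Sum>j\<le>k. real (k choose j) * ?V ^ j * ?U ^ (k - j)) * (exp (- ?U) * exp (- ?V)) / fact k"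
      by (simp add: binomial_ring exp_add[symmetric])
    also have "\<dots> = (\<Sum>j\<le>k. real (k choose j) / fact k * (a (k - j) (Y \<omega>) * B j \<omega>))"
      by (simp add: sum_distrib_left sum_distrib_right sum_divide_distrib a_def B_def mult_ac)
    finally show "(s * (Y \<omega> + 1 + interference_power \<omega>)) ^ k * exp (- (s * (Y \<omega> + 1 + interference_power \<omega>))) / fact k =
        (\<Sum>j\<le>k. real (k choose j) / fact k * (a (k - j) (Y \<omega>) * B j \<omega>))"
      by (simp only: UV)
  qed
  have "expectation (\<lambda>\<omega>. gamma_tail m (s * (Y \<omega> + 1 + interference_power \<omega>))) =
      (\<Sum>k<m. \<Sum>j\<le>k. real (k choose j) / fact k * (shifted_moment M Y s (k - j) * expectation (B j)))"
    unfolding expand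
    by (subst Bochner_Integration.integral_sum;
        (intro Bochner_Integration.integrable_sum integrable_mult_right mult_int)?)
      (intro sum.cong refl, subst Bochner_Integration.integral_sum;
        (intro integrable_mult_right mult_int)?; simp add: mult_exp a_exp)
  also have "\<dots> = exp (- x) * poly (success_poly (2 / \<alpha>) (shifted_moment M Y s) m) x"
    by (simp add: success_poly_def poly_sum B_exp sum_distrib_left mult_ac)
  finally show ?thesis
    using outage_gamma_tail_interference[OF assms] by (simp only: s_def x_def)
qed

end

section \<open>Inversion of the outage probability\<close>

text \<open>\<open>G\<close> is not assumed to be monotone: it is increasing near 0, and by compactness it stays away from
  \<open>G 0\<close> elsewhere, so that values slightly above \<open>G 0\<close> are attained exactly once.\<close>

lemma the_inv_into_first_order:
  fixes F G G' G'' :: "real \<Rightarrow> real"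
  assumes G': "\<And>x. (G has_real_derivative G' x) (at x)"
    and G'': "\<And>x. (G' has_real_derivative G'' x) (at x)"
    and cont: "continuous_on UNIV G''" and pos: "0 < G' 0"
    and greater: "\<And>x. 0 < x \<Longrightarrow> G 0 < G x" and lim: "(G \<longlongrightarrow> L) at_top" "G 0 < L"
    and FG: "\<And>x. 0 < x \<Longrightarrow> F x = G x"
  shows "\<exists>C. eventually (\<lambda>y. \<bar>the_inv_into {0<..} F y - (y - G 0) / G' 0\<bar> \<le> C * (y - G 0)\<^sup>2)
    (at_right (G 0))"
proof -
  \<comment> \<open>Half the slope at 0 is a lower bound for \<open>G'\<close> on a whole interval
    \<open>{0..r}\<close>. It gives injectivity there and bounds the solution \<open>x\<close> by a
    multiple of \<open>y - G 0\<close>.\<close>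
  define a where "a = G' 0 / 2"
  have "0 < a"
    using pos by (simp add: a_def)
  have "isCont G' 0"
    using G'' by (rule DERIV_isCont)
  then have "eventually (\<lambda>x. a < G' x) (at 0)"
    using pos by (intro order_tendstoD(1)) (auto simp: isCont_def a_def)
  then obtain d where d: "0 < d" "\<And>x. x \<noteq> 0 \<Longrightarrow> \<bar>x\<bar> < d \<Longrightarrow> a < G' x"
    by (auto simp: eventually_at dist_real_def)
  define r where "r = d / 2"
  have "0 < r"
    using d by (simp add: r_def)
  have slope: "a \<le> G' x" if "0 \<le> x" "x \<le> r" for x
  proof (cases "x = 0")
    case True
    then show ?thesis
      using pos by (simp add: a_def)
  next
    case False
    then have "a < G' x"
      using that d(1) by (intro d(2)) (auto simp: r_def)
    then show ?thesis by simp
  qed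
  have incr: "a * (y - x) \<le> G y - G x" if "0 \<le> x" "x < y" "y \<le> r" for x y
  proof -
    obtain z where z: "x < z" "z < y" "G y - G x = (y - x) * G' z"
      using MVT2[OF \<open>x < y\<close>, of G G'] G' by blast
    have "a * (y - x) \<le> G' z * (y - x)"
      using that z by (intro mult_right_mono slope) auto
    then show ?thesis
      by (simp add: z(3) mult.commute)
  qed
  have "compact (G'' ` {0..r})"
    by (intro compact_continuous_image continuous_on_subset[OF cont]) auto
  then have "bounded (G'' ` {0..r})"
    by (rule compact_imp_bounded)
  then obtain B where "\<forall>y\<in>G'' ` {0..r}. norm y \<le> B"
    by (auto simp: bounded_iff)
  then have B: "\<bar>G'' x\<bar> \<le> B" if "0 \<le> x" "x \<le> r" for x
    using that by auto
  have "0 \<le> B"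
    using B[of 0] \<open>0 < r\<close> by simp
  \<comment> \<open>Two applications of the mean value theorem; the factor one half of Taylor's
    formula is given up.\<close>
  have taylor: "\<bar>G x - G 0 - G' 0 * x\<bar> \<le> B * x\<^sup>2" if x: "0 < x" "x \<le> r" for x
  proof -
    obtain z where z: "0 < z" "z < x" "G x - G 0 = (x - 0) * G' z"
      using MVT2[OF x(1), of G G'] G' by blast
    obtain w where w: "0 < w" "w < z" "G' z - G' 0 = (z - 0) * G'' w"
      using MVT2[OF z(1), of G' G''] G'' by blast
    have "G x - G 0 - G' 0 * x = x * (G' z - G' 0)"
      using z(3) by (simp add: algebra_simps)
    also have "\<dots> = (x * z) * G'' w"
      by (simp add: w(3))
    finally have "\<bar>G x - G 0 - G' 0 * x\<bar> = (x * z) * \<bar>G'' w\<bar>"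
      using x z by (simp add: abs_mult)
    also have "\<dots> \<le> (x * x) * B"
    proof (rule mult_mono)
      show "x * z \<le> x * x"
        using x z by (intro mult_left_mono) auto
      show "\<bar>G'' w\<bar> \<le> B"
        using x z w by (intro B) auto
    qed (use x in auto)
    finally show ?thesis
      by (simp add: power2_eq_square mult.commute)
  qed
  \<comment> \<open>The gap is the smaller of two: the minimum of \<open>G\<close> over a compact
    interval exceeds \<open>G 0\<close>, and beyond \<open>R\<close> the function stays above the
    midpoint between \<open>G 0\<close> and its limit.\<close>
  obtain e where e: "0 < e" "\<And>x. r \<le> x \<Longrightarrow> G 0 + e \<le> G x"
  proof -
    have "eventually (\<lambda>x. (G 0 + L) / 2 < G x) at_top"
      using lim by (intro order_tendstoD(1)) auto
    then obtain R where R: "\<And>x. R \<le> x \<Longrightarrow> (G 0 + L) / 2 < G x"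
      by (auto simp: eventually_at_top_linorder)
    have "continuous_on {r..max r R} G"
      by (intro continuous_at_imp_continuous_on ballI DERIV_isCont[OF G'])
    then obtain x0 where x0: "r \<le> x0" "\<And>x. r \<le> x \<Longrightarrow> x \<le> max r R \<Longrightarrow> G x0 \<le> G x"
      using continuous_attains_inf[of "{r..max r R}" G] by auto
    show thesis
    proof
      show "0 < min (G x0 - G 0) ((L - G 0) / 2)"
        using greater[of x0] x0(1) \<open>0 < r\<close> lim(2) by auto
      show "G 0 + min (G x0 - G 0) ((L - G 0) / 2) \<le> G x" if "r \<le> x" for x
      proof (cases "x \<le> max r R")
        case True
        then have "G x0 \<le> G x"
          by (rule x0(2)[OF that])
        then show ?thesis by simp
      next
        case False
        then have "(G 0 + L) / 2 < G x"
          by (intro R) simp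
        then show ?thesis by (simp add: min_def field_simps)
      qed
    qed
  qed
  \<comment> \<open>The Taylor error \<open>B * x\<^sup>2\<close> is divided by the slope
    \<open>G' 0\<close>, and \<open>x\<close> is replaced by its bound
    \<open>(y - G 0) / a\<close>.\<close>
  define C where "C = B / (a\<^sup>2 * G' 0)"
  have "\<bar>the_inv_into {0<..} F y - (y - G 0) / G' 0\<bar> \<le> C * (y - G 0)\<^sup>2"
    if y: "G 0 < y" "y < G 0 + e" for y
  proof -
    have "continuous_on {0..r} G"
      by (intro continuous_at_imp_continuous_on ballI DERIV_isCont[OF G'])
    then obtain x where x: "0 \<le> x" "x \<le> r" "G x = y"
      using IVT'[of G 0 y r] y e(2)[of r] \<open>0 < r\<close> by auto
    with y have "0 < x"
      by (cases "x = 0") auto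
    \<comment> \<open>Uniqueness is over all positive arguments: the gap \<open>e\<close> rules out
      solutions at or beyond \<open>r\<close>, and strict growth rules out a second one below
      \<open>r\<close>.\<close>
    have "the_inv_into {0<..} F y = x"
      unfolding the_inv_into_def
    proof (rule the_equality)
      show "x \<in> {0<..} \<and> F x = y"
        using x \<open>0 < x\<close> FG by simp
      fix z assume "z \<in> {0<..} \<and> F z = y"
      then have z: "0 < z" "G z = y"
        using FG by auto
      then have "z < r"
        using e(2)[of z] y by (cases "z < r") auto
      show "z = x"
      proof (rule ccontr)
        assume "z \<noteq> x"
        then consider "z < x" | "x < z" by linarith
        then show False
        proof cases
          case 1
          then have "0 < a * (x - z)"
            using \<open>0 < a\<close> by simp
          then show False
            using incr[of z x] 1 z x by simp
        next
          case 2
          then have "0 < a * (z - x)"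
            using \<open>0 < a\<close> by simp
          then show False
            using incr[of x z] 2 z x \<open>z < r\<close> by simp
        qed
      qed
    qed
    moreover have "\<bar>x - (y - G 0) / G' 0\<bar> \<le> C * (y - G 0)\<^sup>2"
    proof -
      have ax: "a * x \<le> y - G 0"
        using incr[of 0 x] \<open>0 < x\<close> x by simp
      have "x - (y - G 0) / G' 0 = - (G x - G 0 - G' 0 * x) / G' 0"
        using pos x(3) by (simp add: field_simps)
      then have "\<bar>x - (y - G 0) / G' 0\<bar> = \<bar>G x - G 0 - G' 0 * x\<bar> / G' 0"
        using pos by (simp add: abs_divide)
      also have "\<dots> \<le> B * x\<^sup>2 / G' 0"
        using taylor[OF \<open>0 < x\<close> x(2)] pos by (intro divide_right_mono) auto
      also have "\<dots> = C * (a * x)\<^sup>2"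
        using \<open>0 < a\<close> by (simp add: C_def power_mult_distrib field_simps)
      also have "\<dots> \<le> C * (y - G 0)\<^sup>2"
        using ax \<open>0 < a\<close> \<open>0 < x\<close> \<open>0 \<le> B\<close> pos
        by (intro mult_left_mono power_mono) (auto simp: C_def)
      finally show ?thesis .
    qed
    ultimately show ?thesis
      by simp
  qed
  moreover have "eventually (\<lambda>y. y \<in> {G 0<..<G 0 + e}) (at_right (G 0))"
    by (rule eventually_at_right_real) (use e(1) in simp)
  ultimately show ?thesis
    by (intro exI[of _ C]) (auto elim!: eventually_mono)
qed

section \<open>Decay and slope of an exponential times a polynomial\<close>

lemma has_derivative_exp_poly:
  "((\<lambda>x. exp (- (c * x)) * poly Q (c * x)) has_real_derivative
    c * (exp (- (c * x)) * poly (pderiv Q - Q) (c * x))) (at x)"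
proof -
  have e: "((\<lambda>x. exp (- (c * x))) has_real_derivative exp (- (c * x)) * - c) (at x)"
    by (auto intro!: derivative_eq_intros)
  have p: "((\<lambda>x. poly Q (c * x)) has_real_derivative poly (pderiv Q) (c * x) * c) (at x)"
    by (rule DERIV_chain2[OF poly_DERIV]) (auto intro!: derivative_eq_intros)
  show ?thesis
    by (rule DERIV_cong[OF DERIV_mult[OF e p]]) (simp add: algebra_simps)
qed

lemma tendsto_exp_poly:
  assumes "(0::real) < c"
  shows "((\<lambda>x. exp (- (c * x)) * poly Q (c * x)) \<longlongrightarrow> 0) at_top"
proof -
  have "((\<lambda>z. \<Sum>i\<le>degree Q. coeff Q i * (z ^ i / exp z)) \<longlongrightarrow> (\<Sum>i\<le>degree Q. coeff Q i * 0)) at_top"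
    by (intro tendsto_sum tendsto_mult_left tendsto_power_div_exp_0)
  then have "((\<lambda>z. exp (- z) * poly Q z) \<longlongrightarrow> 0) at_top"
    by (simp add: poly_altdef sum_distrib_left exp_minus divide_inverse mult_ac)
  moreover have "filterlim (\<lambda>x. c * x) at_top at_top"
    using assms by (intro filterlim_tendsto_pos_mult_at_top[OF tendsto_const]) (auto simp: filterlim_ident)
  ultimately show ?thesis
    by (rule filterlim_compose)
qed

text \<open>The summands are the power series coefficients of \<open>(1 - z) powr d\<close>. Partial
  summation amounts to division by \<open>1 - z\<close>, which gives the coefficients of
  \<open>(1 - z) powr (d - 1)\<close>.\<close>

lemma sum_pochhammer_minus:
  "(\<Sum>j<Suc N. pochhammer (- d) j / fact j) = pochhammer (1 - d) N / (fact N :: real)"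
proof (induction N)
  case (Suc N)
  have "(\<Sum>j<Suc (Suc N). pochhammer (- d) j / fact j) =
      pochhammer (1 - d) N / fact N + pochhammer (- d) (Suc N) / fact (Suc N)"
    using Suc by (simp only: sum.lessThan_Suc)
  also have "pochhammer (- d) (Suc N) = - d * pochhammer (1 - d) N"
    using pochhammer_rec[of "- d" N] by (simp add: add.commute)
  also have "pochhammer (1 - d) N / fact N = (real N + 1) * pochhammer (1 - d) N / fact (Suc N)"
    by (simp add: fact_Suc add.commute)
  finally show ?case
    unfolding pochhammer_Suc[of "1 - d"] by (simp only: add_divide_distrib[symmetric]) (simp add: algebra_simps)
qed simp

text \<open>The triangle of pairs with \<open>j + l < m\<close> is summed along \<open>l\<close>
  instead of along the diagonals \<open>j + l = k\<close>.\<close>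

lemma sum_convolution_partial_sums:
  fixes a c :: "nat \<Rightarrow> real"
  shows "(\<Sum>k<m. \<Sum>j\<le>k. c j * a (k - j)) = (\<Sum>l<m. a l * (\<Sum>j<m - l. c j))"
proof (induction m)
  case (Suc m)
  have "(\<Sum>l<Suc m. a l * (\<Sum>j<Suc m - l. c j)) = (\<Sum>l<Suc m. a l * (\<Sum>j<m - l. c j) + a l * c (m - l))"
    by (intro sum.cong refl) (simp add: Suc_diff_le distrib_left)
  also have "\<dots> = (\<Sum>k<m. \<Sum>j\<le>k. c j * a (k - j)) + (\<Sum>l\<le>m. a l * c (m - l))"
    unfolding sum.distrib Suc by (simp only: lessThan_Suc_atMost[symmetric] sum.lessThan_Suc) simp
  also have "(\<Sum>l\<le>m. a l * c (m - l)) = (\<Sum>j\<le>m. c j * a (m - j))"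
    by (rule sum.reindex_bij_witness[of _ "\<lambda>j. m - j" "\<lambda>j. m - j"]) auto
  finally show ?case
    by simp
qed simp

lemma pderiv_sum: "pderiv (sum f A) = (\<Sum>x\<in>A. pderiv (f x))"
  by (induction A rule: infinite_finite_induct) (auto simp: pderiv_add)

text \<open>The left side is minus the slope at 0 of the exponential times the success polynomial.
  The signs of the moments cancel those of the slopes of \<open>stable_poly\<close>, the binomial
  coefficients split into factorials, and for each \<open>l\<close> the sum over
  \<open>j < m - l\<close> closes up to a quotient of Gamma values.\<close>

lemma poly_pderiv_success_poly_0:
  assumes "d < 1"
  shows "- poly (pderiv (success_poly d A m) - success_poly d A m) 0 =
    (\<Sum>l<m. A l / fact l * (Gamma (real m - real l - d) / (Gamma (1 - d) * fact (m - l - 1))))"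
proof -
  have "- poly (pderiv (success_poly d A m) - success_poly d A m) 0 =
      (\<Sum>k<m. \<Sum>j\<le>k. real (k choose j) / fact k * ((- 1) ^ j * A (k - j)) *
        - poly (pderiv (stable_poly d j) - stable_poly d j) 0)"
    by (simp add: success_poly_def poly_sum pderiv_sum pderiv_smult sum_negf[symmetric]
        sum_subtractf[symmetric] diff_divide_distrib algebra_simps)
  also have "\<dots> = (\<Sum>k<m. \<Sum>j\<le>k. pochhammer (- d) j / fact j * (A (k - j) / fact (k - j)))"
    unfolding poly_pderiv_stable_poly_0
  proof (intro sum.cong refl)
    fix k j :: nat assume "j \<in> {..k}"
    then have "real (k choose j) / (fact k :: real) = 1 / (fact j * fact (k - j))"
      by (simp add: binomial_fact)
    then show "real (k choose j) / fact k * ((- 1) ^ j * A (k - j)) * - (- ((- 1) ^ j * pochhammer (- d) j)) =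
        pochhammer (- d) j / fact j * (A (k - j) / fact (k - j))"
      by (simp add: power_mult_distrib[symmetric] mult_ac flip: power_add)
  qed
  also have "\<dots> = (\<Sum>l<m. A l / fact l * (\<Sum>j<m - l. pochhammer (- d) j / fact j))"
    by (rule sum_convolution_partial_sums)
  also have "\<dots> = (\<Sum>l<m. A l / fact l * (Gamma (real m - real l - d) / (Gamma (1 - d) * fact (m - l - 1))))"
  proof (intro sum.cong refl)
    fix l assume "l \<in> {..<m}"
    then have m: "m - l = Suc (m - l - 1)"
      by auto
    have "(\<Sum>j<m - l. pochhammer (- d) j / fact j) = pochhammer (1 - d) (m - l - 1) / fact (m - l - 1)"
      by (subst m) (rule sum_pochhammer_minus)
    also have "pochhammer (1 - d) (m - l - 1) = Gamma (1 - d + real (m - l - 1)) / Gamma (1 - d)"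
      using assms by (intro pochhammer_Gamma) (auto dest: nonpos_Ints_nonpos)
    also have "1 - d + real (m - l - 1) = real m - real l - d"
      using \<open>l \<in> {..<m}\<close> by (auto simp: of_nat_diff)
    finally show "A l / fact l * (\<Sum>j<m - l. pochhammer (- d) j / fact j) =
        A l / fact l * (Gamma (real m - real l - d) / (Gamma (1 - d) * fact (m - l - 1)))"
      by simp
  qed
  finally show ?thesis .
qed

section \<open>Leading coefficient\<close>

lemma binomial_quotient_Gamma:
  assumes "k < m"
  shows "real ((m - 1) choose k) = Gamma (real m) / (Gamma (real m - real k) * fact k)"
proof -
  have "Gamma (1 + real (m - 1)) = fact (m - 1)" "Gamma (1 + real (m - 1 - k)) = fact (m - 1 - k)"
    by (rule Gamma_fact)+
  moreover have "1 + real (m - 1) = real m" "1 + real (m - 1 - k) = real m - real k"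
    using assms by (auto simp: of_nat_diff)
  ultimately show ?thesis
    using assms by (simp add: binomial_fact mult.commute)
qed

text \<open>The first parameter is minus the natural number \<open>m - 1\<close>, so the series
  stops there. Both rising factorials start at negative arguments for \<open>k > 0\<close>;
  reversing them gives quotients of Gamma at positive arguments, with signs that cancel in the
  ratio.\<close>

lemma kummer_1F1_terminating:
  assumes "0 < m" "0 < d" "d < 1"
  shows "kummer_1F1 (1 - real m) (1 + d - real m) z =
    (\<Sum>k\<le>m - 1. real ((m - 1) choose k) * (Gamma (real m - real k - d) / Gamma (real m - d)) * z ^ k)"
proof -
  let ?t = "\<lambda>k. pochhammer (1 - real m) k / pochhammer (1 + d - real m) k * z ^ k / fact k"
  have "?t k = 0" if "k \<notin> {..m - 1}" for k
  proof -
    have "pochhammer (- real (m - 1)) k = 0"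
      using that by (intro pochhammer_of_nat_eq_0_lemma) auto
    then show ?thesis
      using assms(1) by (simp add: of_nat_diff)
  qed
  then have "kummer_1F1 (1 - real m) (1 + d - real m) z = (\<Sum>k\<le>m - 1. ?t k)"
    unfolding kummer_1F1_def by (intro suminf_finite) auto
  also have "\<dots> = (\<Sum>k\<le>m - 1. real ((m - 1) choose k) * (Gamma (real m - real k - d) / Gamma (real m - d)) * z ^ k)"
  proof (intro sum.cong refl)
    fix k assume "k \<in> {..m - 1}"
    then have k: "k < m"
      using assms(1) by auto
    have rising: "pochhammer (- b) k = (- 1) ^ k * (Gamma (b + 1) / Gamma (b + 1 - real k))"
      if "real k < b + 1" for b :: real
    proof -
      have "pochhammer (b - real k + 1) k = Gamma (b - real k + 1 + real k) / Gamma (b - real k + 1)"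
        using that by (intro pochhammer_Gamma) (auto dest: nonpos_Ints_nonpos)
      then show ?thesis
        by (simp add: pochhammer_minus algebra_simps)
    qed
    have p1: "pochhammer (1 - real m) k = (- 1) ^ k * (Gamma (real m) / Gamma (real m - real k))"
      using rising[of "real m - 1"] k by simp
    have p2: "pochhammer (1 + d - real m) k = (- 1) ^ k * (Gamma (real m - d) / Gamma (real m - real k - d))"
      using rising[of "real m - 1 - d"] k assms(3) by (simp add: algebra_simps)
    have "0 < Gamma (real m - d)" "0 < Gamma (real m - real k - d)" "0 < Gamma (real m - real k)"
      using k assms by (auto intro!: Gamma_real_pos)
    then show "?t k = real ((m - 1) choose k) * (Gamma (real m - real k - d) / Gamma (real m - d)) * z ^ k"
      unfolding p1 p2 binomial_quotient_Gamma[OF k] by (simp add: field_simps)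
  qed
  finally show ?thesis .
qed

lemma interference_factor_moments:
  assumes "prob_space M" and "Y \<in> borel_measurable M" and "AE \<omega> in M. 0 \<le> Y \<omega>"
    and "0 < \<beta>" "0 < \<theta>" "2 < \<alpha>" "0 < m"
  shows "interference_factor M Y \<alpha> \<beta> \<theta> m =
    (\<Sum>l\<le>m - 1. real ((m - 1) choose l) * (Gamma (real m - real l - 2 / \<alpha>) / Gamma (real m - 2 / \<alpha>)) *
      shifted_moment M Y (\<beta> / \<theta>) l)"
proof -
  define s where "s = \<beta> / \<theta>"
  have "0 < s"
    using assms by (simp add: s_def)
  have "interference_factor M Y \<alpha> \<beta> \<theta> m =
      (LINT \<omega>|M. (\<Sum>l\<le>m - 1. real ((m - 1) choose l) * (Gamma (real m - real l - 2 / \<alpha>) / Gamma (real m - 2 / \<alpha>)) *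
        ((s * (Y \<omega> + 1)) ^ l * exp (- (s * (Y \<omega> + 1))))))"
    unfolding interference_factor_def
  proof (intro Bochner_Integration.integral_cong refl)
    fix \<omega>
    have arg: "\<beta> * (Y \<omega> + 1) / \<theta> = s * (Y \<omega> + 1)"
      by (simp add: s_def)
    show "exp (- (\<beta> * (Y \<omega> + 1) / \<theta>)) * kummer_1F1 (1 - real m) (1 + 2 / \<alpha> - real m) (\<beta> * (Y \<omega> + 1) / \<theta>) =
      (\<Sum>l\<le>m - 1. real ((m - 1) choose l) * (Gamma (real m - real l - 2 / \<alpha>) / Gamma (real m - 2 / \<alpha>)) *
        ((s * (Y \<omega> + 1)) ^ l * exp (- (s * (Y \<omega> + 1)))))"
      unfolding arg using assms
      by (subst kummer_1F1_terminating) (auto simp: sum_distrib_left mult_ac)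
  qed
  also have "\<dots> = (\<Sum>l\<le>m - 1. real ((m - 1) choose l) * (Gamma (real m - real l - 2 / \<alpha>) / Gamma (real m - 2 / \<alpha>)) *
      shifted_moment M Y s l)"
    unfolding shifted_moment_def using integrable_shifted_moment[OF assms(1-3) \<open>0 < s\<close>]
    by (subst Bochner_Integration.integral_sum) (auto intro!: integrable_mult_right)
  finally show ?thesis
    by (simp only: s_def)
qed

lemma shifted_moment_damped_moment:
  fixes Y :: "'w \<Rightarrow> real"
  assumes "prob_space M" and [measurable]: "Y \<in> borel_measurable M" and Y: "AE \<omega> in M. 0 \<le> Y \<omega>"
    and "0 < \<beta>" "0 < \<theta>"
  shows "shifted_moment M Y (\<beta> / \<theta>) k =
    exp (- \<beta> / \<theta>) * ((\<beta> / \<theta>) ^ k * (\<Sum>\<tau>\<le>k. real (k choose \<tau>) * damped_moment M Y \<beta> \<theta> \<tau>))"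
proof -
  interpret prob_space M by fact
  have int: "integrable M (\<lambda>\<omega>. exp (- (\<beta> * Y \<omega> / \<theta>)) * Y \<omega> ^ j)" for j
    using integrable_laplace_moment[of Y "\<beta> / \<theta>" j] assms by (simp add: mult.commute)
  have "shifted_moment M Y (\<beta> / \<theta>) k =
      (LINT \<omega>|M. (\<Sum>\<tau>\<le>k. exp (- \<beta> / \<theta>) * ((\<beta> / \<theta>) ^ k * real (k choose \<tau>)) * (exp (- (\<beta> * Y \<omega> / \<theta>)) * Y \<omega> ^ \<tau>)))"
    unfolding shifted_moment_def
  proof (intro Bochner_Integration.integral_cong refl)
    fix \<omega>
    have "exp (- (\<beta> / \<theta> * (Y \<omega> + 1))) = exp (- \<beta> / \<theta>) * exp (- (\<beta> * Y \<omega> / \<theta>))"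
      by (simp add: exp_add[symmetric] add_divide_distrib[symmetric] algebra_simps)
    moreover have "(\<beta> / \<theta> * (Y \<omega> + 1)) ^ k = (\<beta> / \<theta>) ^ k * (\<Sum>\<tau>\<le>k. real (k choose \<tau>) * Y \<omega> ^ \<tau>)"
      by (simp only: power_mult_distrib binomial_ring power_one mult_1_right)
    ultimately show "(\<beta> / \<theta> * (Y \<omega> + 1)) ^ k * exp (- (\<beta> / \<theta> * (Y \<omega> + 1))) =
        (\<Sum>\<tau>\<le>k. exp (- \<beta> / \<theta>) * ((\<beta> / \<theta>) ^ k * real (k choose \<tau>)) * (exp (- (\<beta> * Y \<omega> / \<theta>)) * Y \<omega> ^ \<tau>))"
      by (simp only: sum_distrib_left sum_distrib_right mult_ac)
  qed
  also have "\<dots> = exp (- \<beta> / \<theta>) * ((\<beta> / \<theta>) ^ k * (\<Sum>\<tau>\<le>k. real (k choose \<tau>) * damped_moment M Y \<beta> \<theta> \<tau>))"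
    using int by (subst Bochner_Integration.integral_sum)
      (auto simp: damped_moment_def sum_distrib_left mult.assoc intro!: integrable_mult_right)
  finally show ?thesis .
qed

lemma damped_moment_gamma:
  assumes Y: "gamma_distributed M Y u \<Upsilon>" and "0 < u" "0 < \<Upsilon>" "0 < \<beta>" "0 < \<theta>"
  shows "damped_moment M Y \<beta> \<theta> \<tau> =
    Gamma (real \<tau> + u) / (Gamma u * \<Upsilon> powr u) * (\<beta> / \<theta> + 1 / \<Upsilon>) powr (- real \<tau> - u)"
proof -
  have [measurable]: "Y \<in> borel_measurable M"
    using Y by (rule gamma_distributed_measurable)
  have pos: "AE \<omega> in M. 0 < Y \<omega>"
    using Y by (rule gamma_distributed_AE_pos)
  have nn: "(\<integral>\<^sup>+\<omega>. ennreal (exp (- (\<beta> * Y \<omega> / \<theta>)) * Y \<omega> ^ \<tau>) \<partial>M) =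
      (\<integral>\<^sup>+\<omega>. ennreal (Y \<omega> powr real \<tau> * exp (- (\<beta> / \<theta> * Y \<omega>))) \<partial>M)"
    by (intro nn_integral_cong_AE, use pos in eventually_elim) (simp add: powr_realpow mult.commute)
  also have "\<dots> = ennreal (Gamma (u + real \<tau>) / (Gamma u * \<Upsilon> powr u) * (\<beta> / \<theta> + 1 / \<Upsilon>) powr (- real \<tau> - u))"
    using assms by (intro gamma_distributed_moment) (auto intro: add_pos_pos add_pos_nonneg)
  finally have nn: "(\<integral>\<^sup>+\<omega>. ennreal (exp (- (\<beta> * Y \<omega> / \<theta>)) * Y \<omega> ^ \<tau>) \<partial>M) =
      ennreal (Gamma (u + real \<tau>) / (Gamma u * \<Upsilon> powr u) * (\<beta> / \<theta> + 1 / \<Upsilon>) powr (- real \<tau> - u))" .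
  have "AE \<omega> in M. 0 \<le> exp (- (\<beta> * Y \<omega> / \<theta>)) * Y \<omega> ^ \<tau>"
    using pos by eventually_elim simp
  moreover have "0 < Gamma u" "0 < Gamma (u + real \<tau>)"
    using assms(2) by (auto intro!: Gamma_real_pos)
  ultimately show ?thesis
    unfolding damped_moment_def by (subst integral_eq_nn_integral) (simp_all add: nn add.commute)
qed

section \<open>Positivity of the leading coefficient and expansion of the capacity\<close>

lemma shifted_moment_nonneg:
  assumes "AE \<omega> in M. 0 \<le> Y \<omega>" "0 < s"
  shows "0 \<le> shifted_moment M Y s k"
  unfolding shifted_moment_def
proof (rule integral_nonneg_AE)
  show "AE \<omega> in M. 0 \<le> (s * (Y \<omega> + 1)) ^ k * exp (- (s * (Y \<omega> + 1)))"
    using assms(1)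
  proof eventually_elim
    case (elim \<omega>)
    then show ?case
      using assms(2) by simp
  qed
qed

lemma shifted_moment_0_pos:
  assumes "prob_space M" "Y \<in> borel_measurable M" "AE \<omega> in M. 0 \<le> Y \<omega>" "0 < s"
  shows "0 < shifted_moment M Y s 0"
proof -
  interpret prob_space M by fact
  have "0 < expectation (\<lambda>\<omega>. exp (- (s * (Y \<omega> + 1))))"
    using integrable_shifted_moment[OF assms, of 0] by (intro expectation_greater) auto
  then show ?thesis
    by (simp add: shifted_moment_def)
qed

text \<open>To the left of \<open>F0\<close> the capacity and the positive part both vanish, so the
  difference is 0. To the right the factor \<open>1 - \<epsilon>\<close> is common to the capacity
  and its leading term, and it enters the error only through its bound
  \<open>\<bar>1 - F0\<bar> + 1\<close> on a unit interval.\<close>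

lemma transmission_capacity_first_order:
  assumes C: "eventually (\<lambda>\<epsilon>. \<bar>contention_density F \<epsilon> - (\<epsilon> - F0) / K\<bar> \<le> C * (\<epsilon> - F0)\<^sup>2) (at_right F0)"
    and c: "c / I = \<zeta> / K" and "0 < \<zeta>"
  shows "(\<lambda>\<epsilon>. transmission_capacity \<zeta> F0 F \<epsilon> - (1 - \<epsilon>) * c * (pos_part (\<epsilon> - F0) / I))
    \<in> O[at F0](\<lambda>\<epsilon>. pos_part ((\<epsilon> - F0)\<^sup>2))"
proof (rule bigoI)
  define B where "B = \<zeta> * (\<bar>1 - F0\<bar> + 1) * \<bar>C\<bar>"
  have "0 \<le> B"
    using \<open>0 < \<zeta>\<close> by (simp add: B_def)
  have "eventually (\<lambda>\<epsilon>. \<epsilon> \<in> {F0<..<F0 + 1}) (at_right F0)"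
    by (rule eventually_at_right_real) simp
  with C have right: "eventually (\<lambda>\<epsilon>. norm (transmission_capacity \<zeta> F0 F \<epsilon> - (1 - \<epsilon>) * c * (pos_part (\<epsilon> - F0) / I))
      \<le> B * norm (pos_part ((\<epsilon> - F0)\<^sup>2))) (at_right F0)"
  proof eventually_elim
    case (elim \<epsilon>)
    define D where "D = contention_density F \<epsilon> - (\<epsilon> - F0) / K"
    have "(1 - \<epsilon>) * c * ((\<epsilon> - F0) / I) = (1 - \<epsilon>) * (\<epsilon> - F0) * (c / I)"
      by simp
    also have "\<dots> = \<zeta> * (1 - \<epsilon>) * ((\<epsilon> - F0) / K)"
      unfolding c by simp
    finally have leading: "(1 - \<epsilon>) * c * ((\<epsilon> - F0) / I) = \<zeta> * (1 - \<epsilon>) * ((\<epsilon> - F0) / K)" .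
    have "pos_part (\<epsilon> - F0) = \<epsilon> - F0"
      "transmission_capacity \<zeta> F0 F \<epsilon> = \<zeta> * contention_density F \<epsilon> * (1 - \<epsilon>)"
      using elim(2) by (auto simp: pos_part_def transmission_capacity_def)
    then have "transmission_capacity \<zeta> F0 F \<epsilon> - (1 - \<epsilon>) * c * (pos_part (\<epsilon> - F0) / I) =
        \<zeta> * contention_density F \<epsilon> * (1 - \<epsilon>) - \<zeta> * (1 - \<epsilon>) * ((\<epsilon> - F0) / K)"
      by (simp only: leading)
    also have "\<dots> = \<zeta> * (1 - \<epsilon>) * D"
      unfolding D_def by (simp only: right_diff_distrib mult_ac)
    also have "norm \<dots> = \<zeta> * \<bar>1 - \<epsilon>\<bar> * \<bar>D\<bar>"
      using \<open>0 < \<zeta>\<close> by (simp add: abs_mult)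
    also have "\<dots> \<le> \<zeta> * (\<bar>1 - F0\<bar> + 1) * (\<bar>C\<bar> * (\<epsilon> - F0)\<^sup>2)"
    proof (intro mult_mono)
      show "\<bar>1 - \<epsilon>\<bar> \<le> \<bar>1 - F0\<bar> + 1"
        using elim(2) by auto
      have "C * (\<epsilon> - F0)\<^sup>2 \<le> \<bar>C\<bar> * (\<epsilon> - F0)\<^sup>2"
        by (intro mult_right_mono) auto
      then show "\<bar>D\<bar> \<le> \<bar>C\<bar> * (\<epsilon> - F0)\<^sup>2"
        using elim(1) by (simp add: D_def)
    qed (use \<open>0 < \<zeta>\<close> in auto)
    finally show ?case
      by (simp add: B_def pos_part_def mult.assoc)
  qed
  have left: "eventually (\<lambda>\<epsilon>. norm (transmission_capacity \<zeta> F0 F \<epsilon> - (1 - \<epsilon>) * c * (pos_part (\<epsilon> - F0) / I))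
      \<le> B * norm (pos_part ((\<epsilon> - F0)\<^sup>2))) (at_left F0)"
    using \<open>0 \<le> B\<close> by (intro eventually_at_leftI[of "F0 - 1"]) (auto simp: transmission_capacity_def pos_part_def)
  show "eventually (\<lambda>\<epsilon>. norm (transmission_capacity \<zeta> F0 F \<epsilon> - (1 - \<epsilon>) * c * (pos_part (\<epsilon> - F0) / I))
      \<le> B * norm (pos_part ((\<epsilon> - F0)\<^sup>2))) (at F0)"
    using left right by (simp add: eventually_at_split)
qed

text \<open>\<open>K\<close> is the slope of the outage probability in the intensity. Its factor
  \<open>Gamma (1 - d)\<close> from the path loss cancels the one in the denominator of the slope of
  the success polynomial, and what is left is \<open>I\<close> times the reciprocal of the stated
  constant, up to \<open>\<zeta>\<close>. Positivity holds because all coefficients of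
  \<open>I\<close> are positive and \<open>A 0 > 0\<close>.\<close>

lemma leading_coefficient:
  fixes A :: "nat \<Rightarrow> real" and \<zeta> :: real
  assumes "2 < \<alpha>" "0 < \<beta>" "0 < \<theta>" "0 < \<Omega>" "0 < n" "0 < m"
    and A: "\<And>l. 0 \<le> A l" "0 < A 0"
  defines "I \<equiv> (\<Sum>l\<le>m - 1. real ((m - 1) choose l) *
      (Gamma (real m - real l - 2 / \<alpha>) / Gamma (real m - 2 / \<alpha>)) * A l)"
    and "K \<equiv> interference_rate \<alpha> n \<Omega> * (\<beta> / \<theta>) powr (2 / \<alpha>) *
      - poly (pderiv (success_poly (2 / \<alpha>) A m) - success_poly (2 / \<alpha>) A m) 0"
    and "c \<equiv> \<zeta> * \<theta> powr (2 / \<alpha>) * Gamma n * Gamma (real m) /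
      (pi * \<beta> powr (2 / \<alpha>) * \<Omega> powr (2 / \<alpha>) * Gamma (n + 2 / \<alpha>) * Gamma (real m - 2 / \<alpha>))"
  shows "0 < K" "c / I = \<zeta> / K"
proof -
  define d where "d = 2 / \<alpha>"
  have d: "0 < d" "d < 1"
    using assms by (auto simp: d_def)
  have G: "0 < Gamma (real m - d)" "0 < Gamma (1 - d)" "0 < Gamma (real m)" "0 < Gamma n" "0 < Gamma (n + d)"
    using d assms by (auto intro!: Gamma_real_pos)
  have Gl: "0 < Gamma (real m - real l - d)" if "l < m" for l
    using that d by (intro Gamma_real_pos) linarith
  have coeff: "0 < real ((m - 1) choose l) * (Gamma (real m - real l - d) / Gamma (real m - d))" if "l < m" for l
    using that Gl[OF that] G(1) by (intro mult_pos_pos divide_pos_pos) auto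
  have "0 < I"
    unfolding I_def d_def[symmetric]
  proof (rule sum_pos2[of _ 0])
    show "0 < real ((m - 1) choose 0) * (Gamma (real m - real 0 - d) / Gamma (real m - d)) * A 0"
      using coeff[of 0] A(2) \<open>0 < m\<close> by (intro mult_pos_pos) auto
    show "0 \<le> real ((m - 1) choose l) * (Gamma (real m - real l - d) / Gamma (real m - d)) * A l"
      if "l \<in> {..m - 1}" for l
      using that \<open>0 < m\<close> by (intro mult_nonneg_nonneg[OF less_imp_le[OF coeff] A(1)]) auto
  qed auto
  have "- poly (pderiv (success_poly d A m) - success_poly d A m) 0 =
      (\<Sum>l<m. A l / fact l * (Gamma (real m - real l - d) / (Gamma (1 - d) * fact (m - l - 1))))"
    by (rule poly_pderiv_success_poly_0[OF d(2)])
  also have "\<dots> = (\<Sum>l<m. Gamma (real m - d) / (Gamma (1 - d) * Gamma (real m)) *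
      (real ((m - 1) choose l) * (Gamma (real m - real l - d) / Gamma (real m - d)) * A l))"
  proof (intro sum.cong refl)
    fix l assume "l \<in> {..<m}"
    then have l: "l < m" by simp
    have "Gamma (1 + real (m - l - 1)) = fact (m - l - 1)"
      by (rule Gamma_fact)
    moreover have "1 + real (m - l - 1) = real m - real l"
      using l by (auto simp: of_nat_diff)
    ultimately have "real ((m - 1) choose l) = Gamma (real m) / (fact (m - l - 1) * fact l)"
      using binomial_quotient_Gamma[OF l] by simp
    then show "A l / fact l * (Gamma (real m - real l - d) / (Gamma (1 - d) * fact (m - l - 1))) =
        Gamma (real m - d) / (Gamma (1 - d) * Gamma (real m)) *
        (real ((m - 1) choose l) * (Gamma (real m - real l - d) / Gamma (real m - d)) * A l)"
      using G by (simp add: field_simps)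
  qed
  also have "\<dots> = Gamma (real m - d) / (Gamma (1 - d) * Gamma (real m)) * I"
    unfolding I_def d_def[symmetric] sum_distrib_left
    using \<open>0 < m\<close> by (intro sum.cong) auto
  finally have K: "K = pi * Gamma (1 - d) * (Gamma (n + d) / Gamma n * \<Omega> powr d) * (\<beta> powr d / \<theta> powr d) *
      (Gamma (real m - d) / (Gamma (1 - d) * Gamma (real m)) * I)"
    using assms(2,3) unfolding K_def interference_rate_def d_def[symmetric] by (simp add: powr_divide)
  show "0 < K"
    unfolding K using G \<open>0 < I\<close> assms by (intro mult_pos_pos divide_pos_pos) auto
  show "c / I = \<zeta> / K"
    unfolding K c_def d_def[symmetric] using G \<open>0 < I\<close> assms(2-4) by (simp add: field_simps)
qed

text \<open>The leading term keeps the factor \<open>1 - \<epsilon>\<close> of the capacity. As this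
  factor tends to the single-user success probability, which is less than 1, replacing it by 1 would
  change the first-order coefficient and destroy the quadratic error bound. Each intensity has its
  own process \<open>X \<mu>\<close>, and the outage probability depends on it only through the
  closed formula.\<close>

theorem theorem2:
  fixes M :: "'w measure"
    and W Y :: "'w \<Rightarrow> real"
    and X :: "real \<Rightarrow> nat \<Rightarrow> 'w \<Rightarrow> real^2"
    and \<Psi> :: "nat \<Rightarrow> 'w \<Rightarrow> real"
    and \<alpha> \<beta> \<theta> \<Omega> n \<zeta> u \<Upsilon> :: real
    and m :: nat
  assumes "prob_space M"
    and "\<alpha> > 2" "\<beta> > 0" "\<theta> > 0" "\<Omega> > 0" "n > 0" "\<zeta> > 0" "m > 0" "u > 0" "\<Upsilon> > 0"
    and "gamma_distributed M W (real m) \<theta>"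
    and "\<And>\<mu>. \<mu> > 0 \<Longrightarrow> homogeneous_PPP M \<mu> (X \<mu>)"
    and "\<And>l. gamma_distributed M (\<Psi> l) n \<Omega>"
    and "gamma_distributed M Y u \<Upsilon> \<or> (\<forall>\<omega> \<in> space M. Y \<omega> = 0)"
    and "\<And>\<mu>. \<mu> > 0 \<Longrightarrow> mutually_independent M W Y (X \<mu>) \<Psi>"
  shows
    "single_user_outage M W Y \<beta> =
       1 - exp (- \<beta> / \<theta>) * (\<Sum>k<m. (\<beta> / \<theta>) ^ k / fact k *
         (\<Sum>\<tau>\<le>k. real (k choose \<tau>) * damped_moment M Y \<beta> \<theta> \<tau>))
     \<and> (\<lambda>\<epsilon>. transmission_capacity \<zeta> (single_user_outage M W Y \<beta>)
                (\<lambda>\<mu>. outage_probability M (sinr \<alpha> W Y (X \<mu>) \<Psi>) \<beta>) \<epsilon>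
            - (1 - \<epsilon>) *
              (\<zeta> * \<theta> powr (2 / \<alpha>) * Gamma n * Gamma (real m) /
                (pi * \<beta> powr (2 / \<alpha>) * \<Omega> powr (2 / \<alpha>) *
                  Gamma (n + 2 / \<alpha>) * Gamma (real m - 2 / \<alpha>))) *
              (pos_part (\<epsilon> - single_user_outage M W Y \<beta>) / interference_factor M Y \<alpha> \<beta> \<theta> m))
         \<in> O[at (single_user_outage M W Y \<beta>)](\<lambda>\<epsilon>. pos_part ((\<epsilon> - single_user_outage M W Y \<beta>)\<^sup>2))
     \<and> interference_factor M Y \<alpha> \<beta> \<theta> m =
       exp (- \<beta> / \<theta>) / Gamma (real m - 2 / \<alpha>) *
         (\<Sum>l\<le>m - 1. real ((m - 1) choose l) * (\<beta> / \<theta>) ^ l * Gamma (real m - real l - 2 / \<alpha>) *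
           (\<Sum>\<tau>\<le>l. real (l choose \<tau>) * damped_moment M Y \<beta> \<theta> \<tau>))
     \<and> (gamma_distributed M Y u \<Upsilon> \<longrightarrow> (\<forall>\<tau>.
       damped_moment M Y \<beta> \<theta> \<tau> =
         Gamma (real \<tau> + u) / (Gamma u * \<Upsilon> powr u) * (\<beta> / \<theta> + 1 / \<Upsilon>) powr (- real \<tau> - u)))"
proof -
  interpret prob_space M by fact
  have sources: "independent_sources M W Y (X \<mu>) \<Psi>" if "0 < \<mu>" for \<mu>
    using assms(15)[OF that] by unfold_locales
  have interf: "interference M W Y (X \<mu>) \<Psi> \<mu> \<alpha> n \<Omega>" if "0 < \<mu>" for \<mu>
    using sources[OF that] assms(2,5,6) assms(12)[OF that] assms(13) that
    by (simp add: interference_def interference_axioms_def)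
  \<comment> \<open>The single-user outage involves no points, so the independence of
    \<open>W\<close> and \<open>Y\<close> may be taken from any one intensity.\<close>
  interpret independent_sources M W Y "X 1" \<Psi>
    by (rule sources) simp
  have Y_nonneg: "AE \<omega> in M. 0 \<le> Y \<omega>"
    using assms(14)
  proof
    assume "gamma_distributed M Y u \<Upsilon>"
    from gamma_distributed_AE_pos[OF this] show ?thesis
      by eventually_elim simp
  qed auto
  have Y_meas: "Y \<in> borel_measurable M"
    by (rule sources_measurable)
  define A where "A = shifted_moment M Y (\<beta> / \<theta>)"
  have damped: "A k = exp (- \<beta> / \<theta>) * ((\<beta> / \<theta>) ^ k * (\<Sum>\<tau>\<le>k. real (k choose \<tau>) * damped_moment M Y \<beta> \<theta> \<tau>))" for k
    unfolding A_def by (rule shifted_moment_damped_moment) (use assms Y_nonneg Y_meas in auto)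
  have F0: "single_user_outage M W Y \<beta> = 1 - (\<Sum>k<m. A k / fact k)"
    unfolding A_def by (rule single_user_outage_moments) (use assms Y_nonneg in auto)
  have I: "interference_factor M Y \<alpha> \<beta> \<theta> m = (\<Sum>l\<le>m - 1. real ((m - 1) choose l) *
      (Gamma (real m - real l - 2 / \<alpha>) / Gamma (real m - 2 / \<alpha>)) * A l)"
    unfolding A_def by (rule interference_factor_moments) (use assms Y_nonneg Y_meas in auto)
  define F where "F = (\<lambda>\<mu>. outage_probability M (sinr \<alpha> W Y (X \<mu>) \<Psi>) \<beta>)"
  define P where "P = success_poly (2 / \<alpha>) A m"
  define \<kappa> where "\<kappa> = interference_rate \<alpha> n \<Omega> * (\<beta> / \<theta>) powr (2 / \<alpha>)"
  have "0 < \<kappa>"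
    unfolding \<kappa>_def using interference.rate_pos[OF interf[of 1]] assms(3,4) by simp
  \<comment> \<open>\<open>G\<close> extends the outage probability from positive intensities to a
    smooth function on the whole line, so that two-sided derivatives at 0 make sense.\<close>
  define G where "G = (\<lambda>x. 1 - exp (- (\<kappa> * x)) * poly P (\<kappa> * x))"
  define G' where "G' = (\<lambda>x. - (\<kappa> * (exp (- (\<kappa> * x)) * poly (pderiv P - P) (\<kappa> * x))))"
  define G'' where "G'' = (\<lambda>x. - (\<kappa> * (\<kappa> * (exp (- (\<kappa> * x)) *
      poly (pderiv (pderiv P - P) - (pderiv P - P)) (\<kappa> * x)))))"
  define K where "K = \<kappa> * - poly (pderiv P - P) 0"
  have G'0: "G' 0 = K"
    by (simp add: G'_def K_def algebra_simps)
  have FG: "F \<mu> = G \<mu>" if "0 < \<mu>" for \<mu>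
  proof -
    have "F \<mu> = 1 - exp (- (\<mu> * interference_rate \<alpha> n \<Omega> * (\<beta> / \<theta>) powr (2 / \<alpha>))) *
        poly P (\<mu> * interference_rate \<alpha> n \<Omega> * (\<beta> / \<theta>) powr (2 / \<alpha>))"
      unfolding F_def P_def A_def
      by (rule interference.outage_formula[OF interf[OF that]]) (use assms Y_nonneg in auto)
    then show ?thesis
      by (simp add: G_def \<kappa>_def mult_ac)
  qed
  have G0: "G 0 = single_user_outage M W Y \<beta>"
    by (simp add: G_def P_def poly_success_poly_0 F0)
  have A_nonneg: "0 \<le> A l" for l
    unfolding A_def by (rule shifted_moment_nonneg) (use assms Y_nonneg in auto)
  have A_pos: "0 < A 0"
    unfolding A_def by (rule shifted_moment_0_pos) (use assms Y_nonneg Y_meas in auto)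
  have "0 < K" and ratio: "\<zeta> * \<theta> powr (2 / \<alpha>) * Gamma n * Gamma (real m) /
      (pi * \<beta> powr (2 / \<alpha>) * \<Omega> powr (2 / \<alpha>) * Gamma (n + 2 / \<alpha>) * Gamma (real m - 2 / \<alpha>)) /
      interference_factor M Y \<alpha> \<beta> \<theta> m = \<zeta> / K"
    unfolding I K_def \<kappa>_def P_def
    by (rule leading_coefficient; use assms A_nonneg A_pos in simp)+
  have "\<exists>C. eventually (\<lambda>y. \<bar>the_inv_into {0<..} F y - (y - G 0) / G' 0\<bar> \<le> C * (y - G 0)\<^sup>2) (at_right (G 0))"
  proof (rule the_inv_into_first_order[where G''=G'' and L=1])
    show "(G has_real_derivative G' x) (at x)" for x
      unfolding G_def G'_def using DERIV_diff[OF DERIV_const has_derivative_exp_poly] by simp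
    show "(G' has_real_derivative G'' x) (at x)" for x
      unfolding G'_def G''_def by (intro DERIV_minus DERIV_cmult has_derivative_exp_poly)
    show "continuous_on UNIV G''"
      unfolding G''_def by (intro continuous_intros)
    show "0 < G' 0"
      unfolding G'0 by fact
    show "G 0 < G x" if "0 < x" for x
      unfolding G0 FG[OF that, symmetric] F_def
      by (rule interference.single_user_outage_less[OF interf[OF that], where \<theta>=\<theta>]) (use assms Y_nonneg in auto)
    show "(G \<longlongrightarrow> 1) at_top"
      unfolding G_def using tendsto_diff[OF tendsto_const tendsto_exp_poly[OF \<open>0 < \<kappa>\<close>]] by force
    \<comment> \<open>This sum is the single-user success probability; its positivity separates
      \<open>G 0\<close> from the limit 1.\<close>
    have "0 < (\<Sum>k<m. A k / fact k)"
      using A_nonneg A_pos \<open>m > 0\<close> by (intro sum_pos2[of _ 0]) auto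
    then show "G 0 < 1"
      by (simp add: G0 F0)
  qed (rule FG)
  then obtain C where C: "eventually (\<lambda>\<epsilon>. \<bar>contention_density F \<epsilon> - (\<epsilon> - single_user_outage M W Y \<beta>) / K\<bar> \<le>
      C * (\<epsilon> - single_user_outage M W Y \<beta>)\<^sup>2) (at_right (single_user_outage M W Y \<beta>))"
    unfolding G0 G'0 contention_density_def by blast
  show ?thesis
  proof (intro conjI impI allI)
    show "single_user_outage M W Y \<beta> =
       1 - exp (- \<beta> / \<theta>) * (\<Sum>k<m. (\<beta> / \<theta>) ^ k / fact k *
         (\<Sum>\<tau>\<le>k. real (k choose \<tau>) * damped_moment M Y \<beta> \<theta> \<tau>))"
      unfolding F0 damped by (simp add: sum_distrib_left sum_divide_distrib)
    show "interference_factor M Y \<alpha> \<beta> \<theta> m =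
       exp (- \<beta> / \<theta>) / Gamma (real m - 2 / \<alpha>) *
         (\<Sum>l\<le>m - 1. real ((m - 1) choose l) * (\<beta> / \<theta>) ^ l * Gamma (real m - real l - 2 / \<alpha>) *
           (\<Sum>\<tau>\<le>l. real (l choose \<tau>) * damped_moment M Y \<beta> \<theta> \<tau>))"
      unfolding I damped by (simp add: sum_distrib_left sum_divide_distrib mult_ac)
    show "damped_moment M Y \<beta> \<theta> \<tau> =
        Gamma (real \<tau> + u) / (Gamma u * \<Upsilon> powr u) * (\<beta> / \<theta> + 1 / \<Upsilon>) powr (- real \<tau> - u)"
      if "gamma_distributed M Y u \<Upsilon>" for \<tau>
      using that assms by (intro damped_moment_gamma)
  qed (rule transmission_capacity_first_order[OF C[unfolded F_def] ratio \<open>\<zeta> > 0\<close>])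
qed

end
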